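(* There exist a unital operator algebra $A$, a peak projection $q$ for $A$, and an element $b \in A$ with $\Vert bq \Vert \leq 1$, such that there is no element $g \in A$ with $\Vert g \Vert \leq 1$ and $gq = bq$.
   Context: An operator algebra is a norm closed algebra of operators on a Hilbert space; it is unital if it has an identity of norm $1$. The bidual $A^{**}$ is an operator algebra with its (unique) Arens product; if $A$ is a subalgebra of a $C^*$-algebra $B$, then $A^{**} \cong A^{\perp\perp} \subset B^{**}$ with the product of the von Neumann algebra $B^{**}$. A projection means an orthogonal (self-adjoint) projection. For $a$ in the closed unit ball of $A$, let $u(a) \in B^{**}$ be the weak* limit of $a(a^*a)^n$ as $n\to\infty$; if $u(a)$ is a projection then it also equals the weak* limit $\lim_n a^n$ (so lies in $A^{**}$), and it is called a peak projection for $A$. *)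

theory Defs
  imports "HOL-Analysis.Analysis"
begin

section \<open>Complex normed spaces and complex Hilbert spaces\<close>

class complex_normed_vector = real_normed_vector +
  fixes scaleC :: "complex \<Rightarrow> 'a \<Rightarrow> 'a" (infixr \<open>*\<^sub>C\<close> 75)
  assumes scaleC_add_right: "c *\<^sub>C (x + y) = c *\<^sub>C x + c *\<^sub>C y"
    and scaleC_add_left: "(c + d) *\<^sub>C x = c *\<^sub>C x + d *\<^sub>C x"
    and scaleC_scaleC: "c *\<^sub>C d *\<^sub>C x = (c * d) *\<^sub>C x"
    and scaleC_of_real: "complex_of_real r *\<^sub>C x = r *\<^sub>R x"
    and norm_scaleC: "norm (c *\<^sub>C x) = cmod c * norm x"

text \<open>The inner product is linear in the first and conjugate-linear in the second variable; it is
  positive definite because it induces the norm.\<close>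

class chilbert_space = complex_normed_vector + complete_space +
  fixes cinner :: "'a \<Rightarrow> 'a \<Rightarrow> complex"
  assumes cinner_commute: "cinner x y = cnj (cinner y x)"
    and cinner_add_left: "cinner (x + y) z = cinner x z + cinner y z"
    and cinner_scaleC_left: "cinner (c *\<^sub>C x) y = c * cinner x y"
    and cinner_self: "cinner x x = complex_of_real ((norm x)\<^sup>2)"

instantiation complex :: complex_normed_vector
begin

definition scaleC_complex :: "complex \<Rightarrow> complex \<Rightarrow> complex"
  where "scaleC_complex c x = c * x"

instance
  by standard (auto simp: scaleC_complex_def algebra_simps norm_mult scaleR_conv_of_real)

end

lemma scaleC_one [simp]: "1 *\<^sub>C (x::'a::complex_normed_vector) = x"
  using scaleC_of_real[of 1 x] by simp

lemma scaleC_zero_left [simp]: "0 *\<^sub>C (x::'a::complex_normed_vector) = 0"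
  using scaleC_of_real[of 0 x] by simp

lemma scaleC_zero_right [simp]: "c *\<^sub>C (0::'a::complex_normed_vector) = 0"
  using scaleC_add_right[of c "0::'a" 0] by simp

lemma scaleC_minus_right: "c *\<^sub>C (- x) = - (c *\<^sub>C (x::'a::complex_normed_vector))"
  using scaleC_add_right[of c x "- x"] by (simp add: eq_neg_iff_add_eq_0 add.commute)

lemma scaleC_scaleR: "c *\<^sub>C (r *\<^sub>R x) = r *\<^sub>R (c *\<^sub>C x)"
  by (simp add: scaleC_of_real[symmetric] scaleC_scaleC mult.commute)

lemma scaleC_diff_right:
  fixes x y :: "'a::complex_normed_vector"
  shows "c *\<^sub>C (x - y) = c *\<^sub>C x - c *\<^sub>C y"
  using scaleC_add_right[of c x "- y"] by (simp add: scaleC_minus_right)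


section \<open>Bounded complex-linear maps\<close>

definition bounded_clinear :: "('a::complex_normed_vector \<Rightarrow> 'b::complex_normed_vector) \<Rightarrow> bool"
  where "bounded_clinear f \<longleftrightarrow> bounded_linear f \<and> (\<forall>c x. f (c *\<^sub>C x) = c *\<^sub>C f x)"

lemma bounded_clinear_bounded_linear: "bounded_clinear f \<Longrightarrow> bounded_linear f"
  by (simp add: bounded_clinear_def)

lemma bounded_clinearI:
  assumes "\<And>x y. f (x + y) = f x + f y" "\<And>c x. f (c *\<^sub>C x) = c *\<^sub>C f x"
    "\<And>x. norm (f x) \<le> K * norm x"
  shows "bounded_clinear f"
  unfolding bounded_clinear_def
proof (intro conjI allI bounded_linear_intro[where K=K])
  show "f (r *\<^sub>R x) = r *\<^sub>R f x" for r x
    using assms(2)[of "complex_of_real r" x] by (simp add: scaleC_of_real)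
  show "norm (f x) \<le> norm x * K" for x
    using assms(3)[of x] by (simp add: mult.commute)
qed (use assms in auto)

typedef (overloaded) ('a, 'b) cblinfun (\<open>(_ \<Rightarrow>\<^sub>C\<^sub>L /_)\<close> [22, 21] 21) =
  "{f :: 'a::complex_normed_vector \<Rightarrow> 'b::complex_normed_vector. bounded_clinear f}"
  morphisms cblinfun_apply CBlinfun
  by (rule exI[of _ "\<lambda>_. 0"]) (simp add: bounded_clinear_def bounded_linear_zero)

setup_lifting type_definition_cblinfun

lemma cblinfun_eqI: "(\<And>x. cblinfun_apply S x = cblinfun_apply T x) \<Longrightarrow> S = T"
  by transfer auto

instantiation cblinfun :: (complex_normed_vector, complex_normed_vector) complex_normed_vector
begin

lift_definition norm_cblinfun :: "'a \<Rightarrow>\<^sub>C\<^sub>L 'b \<Rightarrow> real" is onorm .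

lift_definition minus_cblinfun :: "'a \<Rightarrow>\<^sub>C\<^sub>L 'b \<Rightarrow> 'a \<Rightarrow>\<^sub>C\<^sub>L 'b \<Rightarrow> 'a \<Rightarrow>\<^sub>C\<^sub>L 'b"
  is "\<lambda>f g x. f x - g x"
  by (simp add: bounded_clinear_def bounded_linear_sub scaleC_diff_right)

definition dist_cblinfun :: "'a \<Rightarrow>\<^sub>C\<^sub>L 'b \<Rightarrow> 'a \<Rightarrow>\<^sub>C\<^sub>L 'b \<Rightarrow> real"
  where "dist_cblinfun a b = norm (a - b)"

definition
  "(uniformity :: (('a \<Rightarrow>\<^sub>C\<^sub>L 'b) \<times> ('a \<Rightarrow>\<^sub>C\<^sub>L 'b)) filter) =
    (INF e\<in>{0 <..}. principal {(x, y). dist x y < e})"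

definition open_cblinfun :: "('a \<Rightarrow>\<^sub>C\<^sub>L 'b) set \<Rightarrow> bool"
  where "open_cblinfun S = (\<forall>x\<in>S. \<forall>\<^sub>F (x', y) in uniformity. x' = x \<longrightarrow> y \<in> S)"

lift_definition uminus_cblinfun :: "'a \<Rightarrow>\<^sub>C\<^sub>L 'b \<Rightarrow> 'a \<Rightarrow>\<^sub>C\<^sub>L 'b" is "\<lambda>f x. - f x"
  by (simp add: bounded_clinear_def bounded_linear_minus scaleC_minus_right)

lift_definition zero_cblinfun :: "'a \<Rightarrow>\<^sub>C\<^sub>L 'b" is "\<lambda>x. 0"
  by (simp add: bounded_clinear_def bounded_linear_zero)

lift_definition plus_cblinfun :: "'a \<Rightarrow>\<^sub>C\<^sub>L 'b \<Rightarrow> 'a \<Rightarrow>\<^sub>C\<^sub>L 'b \<Rightarrow> 'a \<Rightarrow>\<^sub>C\<^sub>L 'b"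
  is "\<lambda>f g x. f x + g x"
  by (simp add: bounded_clinear_def bounded_linear_add scaleC_add_right)

lift_definition scaleR_cblinfun :: "real \<Rightarrow> 'a \<Rightarrow>\<^sub>C\<^sub>L 'b \<Rightarrow> 'a \<Rightarrow>\<^sub>C\<^sub>L 'b" is "\<lambda>r f x. r *\<^sub>R f x"
  by (simp add: bounded_clinear_def bounded_linear_const_scaleR scaleC_scaleR)

lift_definition scaleC_cblinfun :: "complex \<Rightarrow> 'a \<Rightarrow>\<^sub>C\<^sub>L 'b \<Rightarrow> 'a \<Rightarrow>\<^sub>C\<^sub>L 'b" is "\<lambda>c f x. c *\<^sub>C f x"
proof -
  fix c :: complex and f :: "'a \<Rightarrow> 'b"
  assume f: "bounded_clinear f"
  then interpret bounded_linear f by (simp add: bounded_clinear_def)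
  obtain K where K: "\<And>x. norm (f x) \<le> norm x * K" using bounded by blast
  show "bounded_clinear (\<lambda>x. c *\<^sub>C f x)"
  proof (rule bounded_clinearI[where K = "cmod c * K"])
    show "norm (c *\<^sub>C f x) \<le> cmod c * K * norm x" for x
      using mult_left_mono[OF K[of x] norm_ge_zero[of c]] by (simp add: norm_scaleC mult_ac)
  qed (use f in \<open>auto simp: add scaleC_add_right bounded_clinear_def scaleC_scaleC mult.commute\<close>)
qed

definition sgn_cblinfun :: "'a \<Rightarrow>\<^sub>C\<^sub>L 'b \<Rightarrow> 'a \<Rightarrow>\<^sub>C\<^sub>L 'b"
  where "sgn_cblinfun x = scaleR (inverse (norm x)) x"

lemma onorm_scaleC:
  assumes "bounded_clinear f"
  shows "onorm (\<lambda>x. c *\<^sub>C f x) = cmod c * onorm f"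
proof -
  have "onorm (\<lambda>x. c *\<^sub>C f x) = onorm (\<lambda>x. cmod c *\<^sub>R f x)"
    by (simp add: onorm_def norm_scaleC)
  then show ?thesis
    using assms by (simp add: onorm_scaleR bounded_clinear_def)
qed

instance
  apply standard
  unfolding dist_cblinfun_def open_cblinfun_def sgn_cblinfun_def uniformity_cblinfun_def
  apply (rule refl | (transfer, force simp: bounded_clinear_def onorm_triangle onorm_scaleR
        onorm_eq_0 algebra_simps scaleC_add_right scaleC_add_left scaleC_scaleC scaleC_of_real)
      | (transfer, rule onorm_scaleC))+
  done

end

lemma norm_cblinfun: "norm (cblinfun_apply T x) \<le> norm T * norm x"
  by transfer (simp add: bounded_clinear_def onorm)

lemma norm_cblinfun_bound:
  "0 \<le> b \<Longrightarrow> (\<And>x. norm (cblinfun_apply T x) \<le> b * norm x) \<Longrightarrow> norm T \<le> b"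
  by transfer (rule onorm_bound)

lemma cblinfun_apply_add: "cblinfun_apply T (x + y) = cblinfun_apply T x + cblinfun_apply T y"
  by transfer (simp add: bounded_clinear_def linear_simps)

lemma cblinfun_apply_scaleC: "cblinfun_apply T (c *\<^sub>C x) = c *\<^sub>C cblinfun_apply T x"
  by transfer (simp add: bounded_clinear_def)

lift_definition cblinfun_compose ::
  "('b::complex_normed_vector \<Rightarrow>\<^sub>C\<^sub>L 'c::complex_normed_vector) \<Rightarrow>
   ('a::complex_normed_vector \<Rightarrow>\<^sub>C\<^sub>L 'b) \<Rightarrow> ('a \<Rightarrow>\<^sub>C\<^sub>L 'c)" (infixl \<open>o\<^sub>C\<close> 67)
  is "\<lambda>S T x. S (T x)"
  by (simp add: bounded_clinear_def bounded_linear_compose)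

lift_definition id_cblinfun :: "'a::complex_normed_vector \<Rightarrow>\<^sub>C\<^sub>L 'a" is "\<lambda>x. x"
  by (simp add: bounded_clinear_def bounded_linear_ident)

lemma norm_cblinfun_compose: "norm (S o\<^sub>C T) \<le> norm S * norm T"
proof (rule norm_cblinfun_bound)
  show "norm (cblinfun_apply (S o\<^sub>C T) x) \<le> norm S * norm T * norm x" for x
    using order_trans[OF norm_cblinfun[of S "cblinfun_apply T x"]
        mult_left_mono[OF norm_cblinfun[of T x] norm_ge_zero[of S]]]
    by (simp add: cblinfun_compose.rep_eq mult.assoc)
qed simp

primrec cblinfun_power :: "('a::complex_normed_vector \<Rightarrow>\<^sub>C\<^sub>L 'a) \<Rightarrow> nat \<Rightarrow> ('a \<Rightarrow>\<^sub>C\<^sub>L 'a)"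
  where "cblinfun_power T 0 = id_cblinfun"
  | "cblinfun_power T (Suc n) = T o\<^sub>C cblinfun_power T n"


section \<open>Adjoints\<close>

definition cblinfun_adj :: "('h::chilbert_space \<Rightarrow>\<^sub>C\<^sub>L 'h) \<Rightarrow> ('h \<Rightarrow>\<^sub>C\<^sub>L 'h)"
  where "cblinfun_adj T =
    (THE S. \<forall>x y. cinner (cblinfun_apply T x) y = cinner x (cblinfun_apply S y))"

text \<open>The rest of this section proves that the adjoint exists.\<close>

lemma cinner_add_right:
  fixes x y z :: "'h::chilbert_space"
  shows "cinner x (y + z) = cinner x y + cinner x z"
  by (metis cinner_commute cinner_add_left complex_cnj_add)

lemma cinner_scaleC_right:
  fixes x y :: "'h::chilbert_space"
  shows "cinner x (c *\<^sub>C y) = cnj c * cinner x y"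
  by (metis cinner_commute cinner_scaleC_left complex_cnj_mult)

lemma norm_add_sq:
  fixes x y :: "'h::chilbert_space"
  shows "(norm (x + y))\<^sup>2 = (norm x)\<^sup>2 + (norm y)\<^sup>2 + 2 * Re (cinner x y)"
proof -
  have "(norm (x + y))\<^sup>2 = Re (cinner (x + y) (x + y))"
    by (simp only: cinner_self Re_complex_of_real)
  also have "\<dots> = (norm x)\<^sup>2 + (norm y)\<^sup>2 + Re (cinner x y) + Re (cinner y x)"
    by (simp only: cinner_add_left cinner_add_right plus_complex.sel)
      (simp add: cinner_self del: of_real_power)
  also have "Re (cinner y x) = Re (cinner x y)"
    by (metis cinner_commute cnj.simps(1))
  finally show ?thesis by simp
qed

lemma cinner_diff_zero_imp_eq:
  fixes x y :: "'h::chilbert_space"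
  assumes "\<And>z. cinner z x = cinner z y"
  shows "x = y"
proof -
  have "cinner (x - y) x = cinner (x - y) (x - y) + cinner (x - y) y"
    by (simp flip: cinner_add_right)
  then have "cinner (x - y) (x - y) = 0"
    using assms[of "x - y"] by simp
  then have "norm (x - y) = 0"
    unfolding cinner_self by simp
  then show ?thesis by simp
qed

lemma norm_cinner_le:
  fixes x y :: "'h::chilbert_space"
  shows "cmod (cinner x y) \<le> norm x * norm y"
proof -
  have *: "Re (cinner u v) \<le> norm u * norm v" for u v :: 'h
  proof -
    have "(norm (u + v))\<^sup>2 \<le> (norm u + norm v)\<^sup>2"
      by (simp add: norm_triangle_ineq power_mono)
    then show ?thesis by (simp add: norm_add_sq power2_sum)
  qed
  obtain c where c: "cmod c = 1" "c * cinner x y = complex_of_real (cmod (cinner x y))"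
  proof (cases "cinner x y = 0")
    case True
    then show ?thesis using that[of 1] by simp
  next
    case False
    let ?c = "cnj (cinner x y) / complex_of_real (cmod (cinner x y))"
    have "?c * cinner x y = complex_of_real ((cmod (cinner x y))\<^sup>2) / complex_of_real (cmod (cinner x y))"
      by (simp add: complex_norm_square mult.commute del: of_real_power)
    then have "?c * cinner x y = complex_of_real (cmod (cinner x y))"
      using False by (simp add: power2_eq_square)
    moreover have "cmod ?c = 1" using False by (simp add: norm_divide)
    ultimately show ?thesis using that by blast
  qed
  have "cmod (cinner x y) = Re (cinner (c *\<^sub>C x) y)"
    by (simp add: cinner_scaleC_left c(2))
  also have "\<dots> \<le> norm (c *\<^sub>C x) * norm y" by (rule *)
  finally show ?thesis by (simp add: norm_scaleC c(1))
qed

lemma riesz_representation: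
  fixes f :: "'h::chilbert_space \<Rightarrow> complex"
  assumes "bounded_clinear f"
  shows "\<exists>y. \<forall>x. f x = cinner x y"
proof -
  have bl: "bounded_linear f" and fC: "\<And>c x. f (c *\<^sub>C x) = c * f x"
    using assms by (auto simp: bounded_clinear_def scaleC_complex_def)
  interpret f: bounded_linear f by fact
  define F where "F x = (norm x)\<^sup>2 - 2 * Re (f x)" for x
  define M where "M = onorm f"
  have F_lower: "F x \<ge> - M\<^sup>2" for x
  proof -
    have "Re (f x) \<le> M * norm x"
      using onorm[OF bl, of x] complex_Re_le_cmod[of "f x"] by (simp add: M_def)
    then have "F x \<ge> (norm x)\<^sup>2 - 2 * (M * norm x)" by (simp add: F_def)
    moreover have "0 \<le> (norm x - M)\<^sup>2" by simp
    ultimately show ?thesis by (simp add: power2_diff algebra_simps)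
  qed
  define I where "I = (INF x. F x)"
  have bdd: "bdd_below (range F)" using F_lower by (meson bdd_belowI2)
  have I_le: "I \<le> F x" for x unfolding I_def by (rule cINF_lower[OF bdd]) simp
  have "\<exists>x. F x < I + 1 / real (Suc n)" for n
  proof -
    have "I < I + 1 / real (Suc n)" by simp
    then show ?thesis unfolding I_def by (subst (asm) cINF_less_iff[OF _ bdd]) auto
  qed
  then obtain X where X: "\<And>n. F (X n) < I + 1 / real (Suc n)" by metis
  have par: "(norm (x - y))\<^sup>2 = 2 * F x + 2 * F y - 4 * F ((1/2) *\<^sub>R (x + y))" for x y
  proof -
    have "(norm (x - y))\<^sup>2 = (norm x)\<^sup>2 + (norm y)\<^sup>2 + 2 * Re (cinner x (- y))"
      using norm_add_sq[of x "- y"] by simp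
    moreover have "cinner x (- y) = - cinner x y"
      using cinner_scaleC_right[of x "complex_of_real (- 1)" y] by (simp only: scaleC_of_real) simp
    moreover have "4 * (norm ((1/2) *\<^sub>R (x + y)))\<^sup>2 = (norm x)\<^sup>2 + (norm y)\<^sup>2 + 2 * Re (cinner x y)"
      by (simp add: norm_add_sq[symmetric] power_divide)
    ultimately show ?thesis
      by (simp add: F_def f.scaleR f.add algebra_simps)
  qed
  have "Cauchy X"
  proof (rule metric_CauchyI)
    fix e :: real assume e: "e > 0"
    then obtain N where N: "4 / e\<^sup>2 < real N" using reals_Archimedean2 by blast
    have Nn: "1 / real (Suc n) < e\<^sup>2 / 4" if "n \<ge> N" for n
    proof -
      have "4 / e\<^sup>2 < real (Suc n)" using N that by simp
      then show ?thesis using e by (simp add: field_simps)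
    qed
    show "\<exists>N. \<forall>m\<ge>N. \<forall>n\<ge>N. dist (X m) (X n) < e"
    proof (intro exI allI impI)
      fix m n assume "m \<ge> N" "n \<ge> N"
      then have "(norm (X m - X n))\<^sup>2 < e\<^sup>2"
        using par[of "X m" "X n"] X[of m] X[of n] I_le[of "(1/2) *\<^sub>R (X m + X n)"] Nn[of m] Nn[of n]
        by linarith
      then show "dist (X m) (X n) < e"
        using e by (simp add: dist_norm power_less_imp_less_base)
    qed
  qed
  then obtain y where y: "X \<longlonglongrightarrow> y" using Cauchy_convergent_iff convergent_def by blast
  have "(\<lambda>n. F (X n)) \<longlonglongrightarrow> F y"
    unfolding F_def by (intro tendsto_intros y f.tendsto)
  moreover have "(\<lambda>n. I + 1 / real (Suc n)) \<longlonglongrightarrow> I + 0"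
    by (intro tendsto_add tendsto_const) (use LIMSEQ_inverse_real_of_nat in \<open>simp add: inverse_eq_divide\<close>)
  ultimately have "F y \<le> I + 0"
    using X by (intro LIMSEQ_le) (auto intro: less_imp_le)
  then have ymin: "F y \<le> F x" for x using I_le[of x] by simp
  have re: "Re (cinner z y) = Re (f z)" for z
  proof -
    define s where "s = Re (cinner z y) - Re (f z)"
    have quad: "0 \<le> t\<^sup>2 * (norm z)\<^sup>2 + 2 * t * s" for t
    proof -
      have "cinner y (t *\<^sub>R z) = complex_of_real t * cinner y z"
        using cinner_scaleC_right[of y "complex_of_real t" z] by (simp add: scaleC_of_real)
      then have "Re (cinner y (t *\<^sub>R z)) = t * Re (cinner z y)"
        using cinner_commute[of y z] by simp
      then have "F (y + t *\<^sub>R z) = F y + t\<^sup>2 * (norm z)\<^sup>2 + 2 * t * s"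
        by (simp add: F_def norm_add_sq f.add f.scaleR power_mult_distrib s_def algebra_simps)
      then show ?thesis using ymin[of "y + t *\<^sub>R z"] by simp
    qed
    define N where "N = (norm z)\<^sup>2 + 1"
    have N: "N > 0" by (simp add: N_def add_nonneg_pos)
    have "0 \<le> (- s / N)\<^sup>2 * (norm z)\<^sup>2 + 2 * (- s / N) * s" by (rule quad)
    also have "\<dots> \<le> (- s / N)\<^sup>2 * N + 2 * (- s / N) * s"
      by (rule add_mono[OF mult_left_mono order_refl]) (auto simp: N_def)
    also have "\<dots> = - (s\<^sup>2 / N)" using N by (simp add: power2_eq_square field_simps)
    finally have "s\<^sup>2 \<le> 0" using N by (simp add: divide_le_0_iff)
    then show ?thesis by (simp add: s_def)
  qed
  have "f z = cinner z y" for z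
  proof (rule complex_eqI)
    show "Re (f z) = Re (cinner z y)" by (simp add: re)
    show "Im (f z) = Im (cinner z y)"
      using re[of "\<i> *\<^sub>C z"] by (simp add: cinner_scaleC_left fC)
  qed
  then show ?thesis by blast
qed

lemma cinner_adj:
  fixes T :: "'h::chilbert_space \<Rightarrow>\<^sub>C\<^sub>L 'h"
  shows "cinner (cblinfun_apply T x) y = cinner x (cblinfun_apply (cblinfun_adj T) y)"
proof -
  have "\<exists>w. \<forall>x. cinner (cblinfun_apply T x) y = cinner x w" for y
  proof (rule riesz_representation, rule bounded_clinearI)
    fix x
    have "cmod (cinner (cblinfun_apply T x) y) \<le> norm (cblinfun_apply T x) * norm y"
      by (rule norm_cinner_le)
    also have "\<dots> \<le> (norm T * norm x) * norm y"
      by (intro mult_right_mono norm_cblinfun) simp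
    finally show "cmod (cinner (cblinfun_apply T x) y) \<le> (norm T * norm y) * norm x"
      by (simp add: mult_ac)
  qed (simp_all add: cblinfun_apply_add cblinfun_apply_scaleC cinner_add_left cinner_scaleC_left
      scaleC_complex_def)
  then obtain g where g: "\<And>x y. cinner (cblinfun_apply T x) y = cinner x (g y)" by metis
  have "bounded_clinear g"
  proof (rule bounded_clinearI[where K="norm T"])
    show "g (u + v) = g u + g v" for u v
      by (rule cinner_diff_zero_imp_eq) (simp add: cinner_add_right flip: g)
    show "g (c *\<^sub>C u) = c *\<^sub>C g u" for c u
      by (rule cinner_diff_zero_imp_eq) (simp add: cinner_scaleC_right flip: g)
    show "norm (g u) \<le> norm T * norm u" for u
    proof (cases "g u = 0")
      case False
      have "(norm (g u))\<^sup>2 = cmod (cinner (g u) (g u))"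
        by (simp only: cinner_self norm_of_real) simp
      also have "\<dots> = cmod (cinner (cblinfun_apply T (g u)) u)" by (simp add: g)
      also have "\<dots> \<le> norm (cblinfun_apply T (g u)) * norm u" by (rule norm_cinner_le)
      also have "\<dots> \<le> norm T * norm (g u) * norm u"
        by (intro mult_right_mono norm_cblinfun) simp
      finally show ?thesis using False
        by (simp add: power2_eq_square mult_ac)
    qed simp
  qed
  then have ex: "\<forall>x y. cinner (cblinfun_apply T x) y = cinner x (cblinfun_apply (CBlinfun g) y)"
    using g by (simp add: CBlinfun_inverse)
  have uniq: "S = CBlinfun g"
    if "\<forall>x y. cinner (cblinfun_apply T x) y = cinner x (cblinfun_apply S y)" for S
    by (rule cblinfun_eqI, rule cinner_diff_zero_imp_eq) (metis ex that)
  have "cblinfun_adj T = CBlinfun g"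
    unfolding cblinfun_adj_def by (rule the_equality) (use ex uniq in auto)
  then show ?thesis using ex by simp
qed

lemma cblinfun_adj_add: "cblinfun_adj (S + T) = cblinfun_adj S + cblinfun_adj T"
  by (rule cblinfun_eqI, rule cinner_diff_zero_imp_eq)
    (simp add: plus_cblinfun.rep_eq cinner_add_right cinner_add_left flip: cinner_adj)

lemma cblinfun_adj_scaleC: "cblinfun_adj (c *\<^sub>C T) = cnj c *\<^sub>C cblinfun_adj T"
  by (rule cblinfun_eqI, rule cinner_diff_zero_imp_eq)
    (simp add: scaleC_cblinfun.rep_eq cinner_scaleC_right cinner_scaleC_left flip: cinner_adj)

lemma norm_cblinfun_adj_le: "norm (cblinfun_adj T) \<le> norm T"
proof (rule norm_cblinfun_bound)
  fix u
  let ?g = "cblinfun_apply (cblinfun_adj T)"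
  show "norm (?g u) \<le> norm T * norm u"
  proof (cases "?g u = 0")
    case False
    have "(norm (?g u))\<^sup>2 = cmod (cinner (?g u) (?g u))"
      by (simp only: cinner_self norm_of_real) simp
    also have "\<dots> = cmod (cinner (cblinfun_apply T (?g u)) u)" by (simp add: cinner_adj)
    also have "\<dots> \<le> norm (cblinfun_apply T (?g u)) * norm u" by (rule norm_cinner_le)
    also have "\<dots> \<le> norm T * norm (?g u) * norm u"
      by (intro mult_right_mono norm_cblinfun) simp
    finally show ?thesis using False
      by (simp add: power2_eq_square mult_ac)
  qed simp
qed simp


section \<open>Operator algebras on a Hilbert space\<close>

definition operator_algebra :: "('h::chilbert_space \<Rightarrow>\<^sub>C\<^sub>L 'h) set \<Rightarrow> bool"
  where "operator_algebra A \<longleftrightarrow> closed A \<and> 0 \<in> A \<and> (\<forall>S\<in>A. \<forall>T\<in>A. S + T \<in> A) \<and>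
    (\<forall>c. \<forall>T\<in>A. c *\<^sub>C T \<in> A) \<and> (\<forall>S\<in>A. \<forall>T\<in>A. S o\<^sub>C T \<in> A)"

text \<open>The identity of the algebra is not required to be the identity operator.\<close>

definition unital_operator_algebra :: "('h::chilbert_space \<Rightarrow>\<^sub>C\<^sub>L 'h) set \<Rightarrow> bool"
  where "unital_operator_algebra A \<longleftrightarrow> operator_algebra A \<and>
    (\<exists>e\<in>A. norm e = 1 \<and> (\<forall>a\<in>A. e o\<^sub>C a = a \<and> a o\<^sub>C e = a))"


section \<open>The bidual of the algebra of all bounded operators\<close>

text \<open>An operator algebra \<open>A\<close> on \<open>'h\<close> is a subalgebra of the C*-algebra \<open>B\<close> of all bounded
  operators on \<open>'h\<close>.  We compute in \<open>B\<^sup>*\<^sup>*\<close>, which contains \<open>A\<^sup>*\<^sup>*\<close>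
  isometrically as the subalgebra \<open>A\<^sup>\<bottom>\<^sup>\<bottom>\<close>; the choice of the containing C*-algebra does
  not matter.\<close>

type_synonym 'h op_dual = "('h \<Rightarrow>\<^sub>C\<^sub>L 'h) \<Rightarrow>\<^sub>C\<^sub>L complex"
type_synonym 'h op_bidual = "'h op_dual \<Rightarrow>\<^sub>C\<^sub>L complex"

definition bidual_embed :: "('h::chilbert_space \<Rightarrow>\<^sub>C\<^sub>L 'h) \<Rightarrow> 'h op_bidual"
  where "bidual_embed b = CBlinfun (\<lambda>\<phi>. cblinfun_apply \<phi> b)"

lemma bidual_embed_apply:
  fixes b :: "'h::chilbert_space \<Rightarrow>\<^sub>C\<^sub>L 'h"
  shows "cblinfun_apply (bidual_embed b) \<phi> = cblinfun_apply \<phi> b"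
proof -
  have "bounded_clinear (\<lambda>\<phi> :: 'h op_dual. cblinfun_apply \<phi> b)"
    by (rule bounded_clinearI[where K="norm b"])
      (auto simp: plus_cblinfun.rep_eq scaleC_cblinfun.rep_eq norm_cblinfun mult.commute[of "norm b"])
  then show ?thesis
    by (simp add: bidual_embed_def CBlinfun_inverse)
qed

text \<open>The (first) Arens product, in the usual three steps: \<open>(\<phi> \<cdot> a)(b) = \<phi>(a b)\<close>,
  \<open>(G \<cdot> \<phi>)(a) = G(\<phi> \<cdot> a)\<close> and \<open>(F G)(\<phi>) = F(G \<cdot> \<phi>)\<close>.\<close>

definition dual_right_act :: "'h::chilbert_space op_dual \<Rightarrow> ('h \<Rightarrow>\<^sub>C\<^sub>L 'h) \<Rightarrow> 'h op_dual"
  where "dual_right_act \<phi> a = CBlinfun (\<lambda>b. cblinfun_apply \<phi> (a o\<^sub>C b))"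

lemma dual_right_act_apply:
  fixes \<phi> :: "'h::chilbert_space op_dual" and a :: "'h \<Rightarrow>\<^sub>C\<^sub>L 'h"
  shows "cblinfun_apply (dual_right_act \<phi> a) b = cblinfun_apply \<phi> (a o\<^sub>C b)"
proof -
  have "bounded_clinear (\<lambda>b. cblinfun_apply \<phi> (a o\<^sub>C b))"
  proof (rule bounded_clinearI[where K="norm \<phi> * norm a"])
    fix b c :: "'h \<Rightarrow>\<^sub>C\<^sub>L 'h" and k :: complex
    have "a o\<^sub>C (b + c) = a o\<^sub>C b + a o\<^sub>C c"
      by (rule cblinfun_eqI) (simp add: cblinfun_compose.rep_eq plus_cblinfun.rep_eq cblinfun_apply_add)
    then show "cblinfun_apply \<phi> (a o\<^sub>C (b + c)) = cblinfun_apply \<phi> (a o\<^sub>C b) + cblinfun_apply \<phi> (a o\<^sub>C c)"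
      by (simp add: cblinfun_apply_add)
    have "a o\<^sub>C (k *\<^sub>C b) = k *\<^sub>C (a o\<^sub>C b)"
      by (rule cblinfun_eqI) (simp add: cblinfun_compose.rep_eq scaleC_cblinfun.rep_eq cblinfun_apply_scaleC)
    then show "cblinfun_apply \<phi> (a o\<^sub>C (k *\<^sub>C b)) = k *\<^sub>C cblinfun_apply \<phi> (a o\<^sub>C b)"
      by (simp add: cblinfun_apply_scaleC)
    show "cmod (cblinfun_apply \<phi> (a o\<^sub>C b)) \<le> norm \<phi> * norm a * norm b"
      using order_trans[OF norm_cblinfun[of \<phi> "a o\<^sub>C b"]
          mult_left_mono[OF norm_cblinfun_compose[of a b] norm_ge_zero[of \<phi>]]]
      by (simp add: mult.assoc)
  qed
  then show ?thesis
    by (simp add: dual_right_act_def CBlinfun_inverse)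
qed

lemma norm_dual_right_act: "norm (dual_right_act \<phi> a) \<le> norm \<phi> * norm a"
proof (rule norm_cblinfun_bound)
  show "norm (cblinfun_apply (dual_right_act \<phi> a) b) \<le> norm \<phi> * norm a * norm b" for b
    using order_trans[OF norm_cblinfun[of \<phi> "a o\<^sub>C b"]
        mult_left_mono[OF norm_cblinfun_compose[of a b] norm_ge_zero[of \<phi>]]]
    by (simp add: mult.assoc dual_right_act_apply)
qed simp

definition bidual_act :: "'h::chilbert_space op_bidual \<Rightarrow> 'h op_dual \<Rightarrow> 'h op_dual"
  where "bidual_act G \<phi> = CBlinfun (\<lambda>a. cblinfun_apply G (dual_right_act \<phi> a))"

lemma bidual_act_apply:
  fixes G :: "'h::chilbert_space op_bidual" and \<phi> :: "'h op_dual"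
  shows "cblinfun_apply (bidual_act G \<phi>) a = cblinfun_apply G (dual_right_act \<phi> a)"
proof -
  have "bounded_clinear (\<lambda>a. cblinfun_apply G (dual_right_act \<phi> a))"
  proof (rule bounded_clinearI[where K="norm G * norm \<phi>"])
    fix a b :: "'h \<Rightarrow>\<^sub>C\<^sub>L 'h" and k :: complex
    have "(a + b) o\<^sub>C x = a o\<^sub>C x + b o\<^sub>C x" for x :: "'h \<Rightarrow>\<^sub>C\<^sub>L 'h"
      by (rule cblinfun_eqI) (simp add: cblinfun_compose.rep_eq plus_cblinfun.rep_eq)
    then have "dual_right_act \<phi> (a + b) = dual_right_act \<phi> a + dual_right_act \<phi> b"
      by (intro cblinfun_eqI) (simp add: dual_right_act_apply plus_cblinfun.rep_eq cblinfun_apply_add)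
    then show "cblinfun_apply G (dual_right_act \<phi> (a + b)) =
        cblinfun_apply G (dual_right_act \<phi> a) + cblinfun_apply G (dual_right_act \<phi> b)"
      by (simp add: cblinfun_apply_add)
    have "(k *\<^sub>C a) o\<^sub>C x = k *\<^sub>C (a o\<^sub>C x)" for x :: "'h \<Rightarrow>\<^sub>C\<^sub>L 'h"
      by (rule cblinfun_eqI) (simp add: cblinfun_compose.rep_eq scaleC_cblinfun.rep_eq)
    then have "dual_right_act \<phi> (k *\<^sub>C a) = k *\<^sub>C dual_right_act \<phi> a"
      by (intro cblinfun_eqI) (simp add: dual_right_act_apply scaleC_cblinfun.rep_eq cblinfun_apply_scaleC)
    then show "cblinfun_apply G (dual_right_act \<phi> (k *\<^sub>C a)) = k *\<^sub>C cblinfun_apply G (dual_right_act \<phi> a)"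
      by (simp add: cblinfun_apply_scaleC)
    show "cmod (cblinfun_apply G (dual_right_act \<phi> a)) \<le> norm G * norm \<phi> * norm a"
      using order_trans[OF norm_cblinfun[of G "dual_right_act \<phi> a"]
          mult_left_mono[OF norm_dual_right_act[of \<phi> a] norm_ge_zero[of G]]]
      by (simp add: mult.assoc)
  qed
  then show ?thesis
    by (simp add: bidual_act_def CBlinfun_inverse)
qed

lemma norm_bidual_act: "norm (bidual_act G \<phi>) \<le> norm G * norm \<phi>"
proof (rule norm_cblinfun_bound)
  show "norm (cblinfun_apply (bidual_act G \<phi>) a) \<le> norm G * norm \<phi> * norm a" for a
    using order_trans[OF norm_cblinfun[of G "dual_right_act \<phi> a"]
        mult_left_mono[OF norm_dual_right_act[of \<phi> a] norm_ge_zero[of G]]]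
    by (simp add: mult.assoc bidual_act_apply)
qed simp

definition arens_prod :: "'h::chilbert_space op_bidual \<Rightarrow> 'h op_bidual \<Rightarrow> 'h op_bidual" (infixl \<open>\<star>\<close> 70)
  where "F \<star> G = CBlinfun (\<lambda>\<phi>. cblinfun_apply F (bidual_act G \<phi>))"

lemma arens_prod_apply:
  fixes F G :: "'h::chilbert_space op_bidual"
  shows "cblinfun_apply (F \<star> G) \<phi> = cblinfun_apply F (bidual_act G \<phi>)"
proof -
  have "bounded_clinear (\<lambda>\<phi>. cblinfun_apply F (bidual_act G \<phi>))"
  proof (rule bounded_clinearI[where K="norm F * norm G"])
    fix \<phi> \<psi> :: "'h op_dual" and k :: complex
    have "dual_right_act (\<phi> + \<psi>) a = dual_right_act \<phi> a + dual_right_act \<psi> a" for a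
      by (rule cblinfun_eqI) (simp add: dual_right_act_apply plus_cblinfun.rep_eq)
    then have "bidual_act G (\<phi> + \<psi>) = bidual_act G \<phi> + bidual_act G \<psi>"
      by (intro cblinfun_eqI) (simp add: bidual_act_apply plus_cblinfun.rep_eq cblinfun_apply_add)
    then show "cblinfun_apply F (bidual_act G (\<phi> + \<psi>)) =
        cblinfun_apply F (bidual_act G \<phi>) + cblinfun_apply F (bidual_act G \<psi>)"
      by (simp add: cblinfun_apply_add)
    have "dual_right_act (k *\<^sub>C \<phi>) a = k *\<^sub>C dual_right_act \<phi> a" for a
      by (rule cblinfun_eqI) (simp add: dual_right_act_apply scaleC_cblinfun.rep_eq)
    then have "bidual_act G (k *\<^sub>C \<phi>) = k *\<^sub>C bidual_act G \<phi>"
      by (intro cblinfun_eqI) (simp add: bidual_act_apply scaleC_cblinfun.rep_eq cblinfun_apply_scaleC)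
    then show "cblinfun_apply F (bidual_act G (k *\<^sub>C \<phi>)) = k *\<^sub>C cblinfun_apply F (bidual_act G \<phi>)"
      by (simp add: cblinfun_apply_scaleC)
    show "cmod (cblinfun_apply F (bidual_act G \<phi>)) \<le> norm F * norm G * norm \<phi>"
      using order_trans[OF norm_cblinfun[of F "bidual_act G \<phi>"]
          mult_left_mono[OF norm_bidual_act[of G \<phi>] norm_ge_zero[of F]]]
      by (simp add: mult.assoc)
  qed
  then show ?thesis
    by (simp add: arens_prod_def CBlinfun_inverse)
qed

text \<open>The involution of \<open>B\<^sup>*\<^sup>*\<close> is the second transpose of the involution of \<open>B\<close>:
  \<open>\<phi>\<^sup>*(b) = cnj (\<phi>(b\<^sup>*))\<close> on \<open>B\<^sup>*\<close>, and \<open>F\<^sup>*(\<phi>) = cnj (F(\<phi>\<^sup>*))\<close>.\<close>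

definition dual_star :: "'h::chilbert_space op_dual \<Rightarrow> 'h op_dual"
  where "dual_star \<phi> = CBlinfun (\<lambda>b. cnj (cblinfun_apply \<phi> (cblinfun_adj b)))"

lemma dual_star_apply:
  fixes \<phi> :: "'h::chilbert_space op_dual"
  shows "cblinfun_apply (dual_star \<phi>) b = cnj (cblinfun_apply \<phi> (cblinfun_adj b))"
proof -
  have "bounded_clinear (\<lambda>b. cnj (cblinfun_apply \<phi> (cblinfun_adj b)))"
  proof (rule bounded_clinearI[where K="norm \<phi>"])
    fix b :: "'h \<Rightarrow>\<^sub>C\<^sub>L 'h"
    show "cmod (cnj (cblinfun_apply \<phi> (cblinfun_adj b))) \<le> norm \<phi> * norm b"
      using order_trans[OF norm_cblinfun[of \<phi> "cblinfun_adj b"]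
          mult_left_mono[OF norm_cblinfun_adj_le[of b] norm_ge_zero[of \<phi>]]] by simp
  qed (simp_all add: cblinfun_adj_add cblinfun_adj_scaleC cblinfun_apply_add cblinfun_apply_scaleC
      scaleC_complex_def)
  then show ?thesis
    by (simp add: dual_star_def CBlinfun_inverse)
qed

definition bidual_star :: "'h::chilbert_space op_bidual \<Rightarrow> 'h op_bidual"
  where "bidual_star F = CBlinfun (\<lambda>\<phi>. cnj (cblinfun_apply F (dual_star \<phi>)))"

lemma bidual_star_apply:
  fixes F :: "'h::chilbert_space op_bidual"
  shows "cblinfun_apply (bidual_star F) \<phi> = cnj (cblinfun_apply F (dual_star \<phi>))"
proof -
  have "bounded_clinear (\<lambda>\<phi>. cnj (cblinfun_apply F (dual_star \<phi>)))"
  proof (rule bounded_clinearI[where K="norm F"])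
    fix \<phi> \<psi> :: "'h op_dual" and k :: complex
    have "dual_star (\<phi> + \<psi>) = dual_star \<phi> + dual_star \<psi>"
      by (rule cblinfun_eqI) (simp add: dual_star_apply plus_cblinfun.rep_eq)
    then show "cnj (cblinfun_apply F (dual_star (\<phi> + \<psi>))) =
        cnj (cblinfun_apply F (dual_star \<phi>)) + cnj (cblinfun_apply F (dual_star \<psi>))"
      by (simp add: cblinfun_apply_add)
    have "dual_star (k *\<^sub>C \<phi>) = cnj k *\<^sub>C dual_star \<phi>"
      by (rule cblinfun_eqI) (simp add: dual_star_apply scaleC_cblinfun.rep_eq scaleC_complex_def)
    then show "cnj (cblinfun_apply F (dual_star (k *\<^sub>C \<phi>))) = k *\<^sub>C cnj (cblinfun_apply F (dual_star \<phi>))"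
      by (simp add: cblinfun_apply_scaleC scaleC_complex_def)
    have "norm (dual_star \<phi>) \<le> norm \<phi>"
    proof (rule norm_cblinfun_bound)
      show "norm (cblinfun_apply (dual_star \<phi>) b) \<le> norm \<phi> * norm b" for b
        using order_trans[OF norm_cblinfun[of \<phi> "cblinfun_adj b"]
            mult_left_mono[OF norm_cblinfun_adj_le[of b] norm_ge_zero[of \<phi>]]]
        by (simp add: dual_star_apply)
    qed simp
    then show "cmod (cnj (cblinfun_apply F (dual_star \<phi>))) \<le> norm F * norm \<phi>"
      using order_trans[OF norm_cblinfun[of F "dual_star \<phi>"] mult_left_mono[OF _ norm_ge_zero[of F]]]
      by simp
  qed
  then show ?thesis
    by (simp add: bidual_star_def CBlinfun_inverse)
qed

definition bidual_projection :: "'h::chilbert_space op_bidual \<Rightarrow> bool"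
  where "bidual_projection q \<longleftrightarrow> q \<star> q = q \<and> bidual_star q = q"

definition weak_star_limit :: "(nat \<Rightarrow> 'h::chilbert_space op_bidual) \<Rightarrow> 'h op_bidual \<Rightarrow> bool"
  where "weak_star_limit X F \<longleftrightarrow> (\<forall>\<phi>. (\<lambda>n. cblinfun_apply (X n) \<phi>) \<longlonglongrightarrow> cblinfun_apply F \<phi>)"

text \<open>\<open>q\<close> is the weak* limit \<open>u(a)\<close> of \<open>a (a\<^sup>* a)\<^sup>n\<close>, and it is a projection.\<close>

definition peak_projection :: "('h::chilbert_space \<Rightarrow>\<^sub>C\<^sub>L 'h) set \<Rightarrow> 'h op_bidual \<Rightarrow> bool"
  where "peak_projection A q \<longleftrightarrow> (\<exists>a\<in>A. norm a \<le> 1 \<and>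
    weak_star_limit (\<lambda>n. bidual_embed (a o\<^sub>C cblinfun_power (cblinfun_adj a o\<^sub>C a) n)) q \<and>
    bidual_projection q)"


section \<open>The Hilbert space of square-summable sequences\<close>

text \<open>HOL cannot quantify existentially over types, so a witnessing operator algebra has to act on a
  particular Hilbert space type.\<close>

typedef ell2 = "{f :: nat \<Rightarrow> complex. summable (\<lambda>n. (cmod (f n))\<^sup>2)}"
  morphisms ell2_apply Ell2
  by (rule exI[of _ "\<lambda>_. 0"]) simp

setup_lifting type_definition_ell2

lemma ell2_summable: "summable (\<lambda>n. (cmod (ell2_apply x n))\<^sup>2)"
  using ell2_apply[of x] by simp

lemma ell2_eqI: "(\<And>n. ell2_apply x n = ell2_apply y n) \<Longrightarrow> x = y"
  by transfer auto

lemma L2_set_le_ell2: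
  assumes "summable (\<lambda>n. (cmod (f n))\<^sup>2)"
  shows "L2_set (\<lambda>i. cmod (f i)) {..<n} \<le> sqrt (\<Sum>n. (cmod (f n))\<^sup>2)"
  unfolding L2_set_def by (intro real_sqrt_le_mono sum_le_suminf assms) auto

lemma ell2_bound:
  assumes "\<And>n. L2_set (\<lambda>i. cmod (f i)) {..<n} \<le> C"
  shows "summable (\<lambda>n. (cmod (f n))\<^sup>2)" "sqrt (\<Sum>n. (cmod (f n))\<^sup>2) \<le> C"
proof -
  have C: "0 \<le> C" using assms[of 0] by simp
  have le: "(\<Sum>i<n. (cmod (f i))\<^sup>2) \<le> C\<^sup>2" for n
    using assms[of n] unfolding L2_set_def by (rule sqrt_le_D)
  then show s: "summable (\<lambda>n. (cmod (f n))\<^sup>2)"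
    by (intro bounded_imp_summable[where B="C\<^sup>2"]) (simp_all only: zero_le_power2 flip: lessThan_Suc_atMost)
  have "(\<Sum>n. (cmod (f n))\<^sup>2) \<le> C\<^sup>2"
    by (rule suminf_le_const[OF s le])
  then show "sqrt (\<Sum>n. (cmod (f n))\<^sup>2) \<le> C"
    using C real_le_lsqrt by blast
qed

lemma ell2_add:
  assumes "summable (\<lambda>n. (cmod (f n))\<^sup>2)" "summable (\<lambda>n. (cmod (g n))\<^sup>2)"
  shows "summable (\<lambda>n. (cmod (f n + g n))\<^sup>2)"
    "sqrt (\<Sum>n. (cmod (f n + g n))\<^sup>2) \<le> sqrt (\<Sum>n. (cmod (f n))\<^sup>2) + sqrt (\<Sum>n. (cmod (g n))\<^sup>2)"
proof -
  have "L2_set (\<lambda>i. cmod (f i + g i)) {..<n} \<le>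
      sqrt (\<Sum>n. (cmod (f n))\<^sup>2) + sqrt (\<Sum>n. (cmod (g n))\<^sup>2)" for n
  proof -
    have "L2_set (\<lambda>i. cmod (f i + g i)) {..<n} \<le> L2_set (\<lambda>i. cmod (f i) + cmod (g i)) {..<n}"
      by (rule L2_set_mono) (auto simp: norm_triangle_ineq)
    also have "\<dots> \<le> L2_set (\<lambda>i. cmod (f i)) {..<n} + L2_set (\<lambda>i. cmod (g i)) {..<n}"
      by (rule L2_set_triangle_ineq)
    also have "\<dots> \<le> sqrt (\<Sum>n. (cmod (f n))\<^sup>2) + sqrt (\<Sum>n. (cmod (g n))\<^sup>2)"
      by (intro add_mono L2_set_le_ell2 assms)
    finally show ?thesis .
  qed
  from ell2_bound[OF this] show "summable (\<lambda>n. (cmod (f n + g n))\<^sup>2)"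
    "sqrt (\<Sum>n. (cmod (f n + g n))\<^sup>2) \<le> sqrt (\<Sum>n. (cmod (f n))\<^sup>2) + sqrt (\<Sum>n. (cmod (g n))\<^sup>2)"
    by auto
qed

lemma ell2_scale:
  assumes "summable (\<lambda>n. (cmod (f n))\<^sup>2)"
  shows "summable (\<lambda>n. (cmod (c * f n))\<^sup>2)"
    "sqrt (\<Sum>n. (cmod (c * f n))\<^sup>2) = cmod c * sqrt (\<Sum>n. (cmod (f n))\<^sup>2)"
  using assms by (simp_all add: norm_mult power_mult_distrib summable_mult suminf_mult real_sqrt_mult)

lemma ell2_scaleR:
  assumes "summable (\<lambda>n. (cmod (f n))\<^sup>2)"
  shows "summable (\<lambda>n. (cmod (r *\<^sub>R f n))\<^sup>2)"
    "sqrt (\<Sum>n. (cmod (r *\<^sub>R f n))\<^sup>2) = \<bar>r\<bar> * sqrt (\<Sum>n. (cmod (f n))\<^sup>2)"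
  using ell2_scale[OF assms, of "complex_of_real r"] by (simp_all add: scaleR_conv_of_real)

instantiation ell2 :: complex_normed_vector
begin

lift_definition zero_ell2 :: ell2 is "\<lambda>_. 0" by simp
lift_definition plus_ell2 :: "ell2 \<Rightarrow> ell2 \<Rightarrow> ell2" is "\<lambda>f g n. f n + g n"
  by (rule ell2_add)
lift_definition uminus_ell2 :: "ell2 \<Rightarrow> ell2" is "\<lambda>f n. - f n" by simp
lift_definition minus_ell2 :: "ell2 \<Rightarrow> ell2 \<Rightarrow> ell2" is "\<lambda>f g n. f n - g n"
  using ell2_add(1)[of _ "\<lambda>n. - _ n"] by simp
lift_definition scaleR_ell2 :: "real \<Rightarrow> ell2 \<Rightarrow> ell2" is "\<lambda>r f n. r *\<^sub>R f n"
  by (rule ell2_scaleR)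
lift_definition scaleC_ell2 :: "complex \<Rightarrow> ell2 \<Rightarrow> ell2" is "\<lambda>c f n. c * f n"
  by (rule ell2_scale)
lift_definition norm_ell2 :: "ell2 \<Rightarrow> real" is "\<lambda>f. sqrt (\<Sum>n. (cmod (f n))\<^sup>2)" .

definition dist_ell2 :: "ell2 \<Rightarrow> ell2 \<Rightarrow> real" where "dist_ell2 x y = norm (x - y)"
definition sgn_ell2 :: "ell2 \<Rightarrow> ell2" where "sgn_ell2 x = scaleR (inverse (norm x)) x"
definition "(uniformity :: (ell2 \<times> ell2) filter) = (INF e\<in>{0 <..}. principal {(x, y). dist x y < e})"
definition open_ell2 :: "ell2 set \<Rightarrow> bool"
  where "open_ell2 S = (\<forall>x\<in>S. \<forall>\<^sub>F (x', y) in uniformity. x' = x \<longrightarrow> y \<in> S)"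

instance
proof
  fix x y z :: ell2 and r s :: real and c d :: complex
  show "x + y + z = x + (y + z)" by transfer (simp add: add.assoc)
  show "x + y = y + x" by transfer (simp add: add.commute)
  show "0 + x = x" "- x + x = 0" "x - y = x + - y" by (transfer, simp)+
  show "r *\<^sub>R (x + y) = r *\<^sub>R x + r *\<^sub>R y" "(r + s) *\<^sub>R x = r *\<^sub>R x + s *\<^sub>R x"
    "r *\<^sub>R s *\<^sub>R x = (r * s) *\<^sub>R x" "1 *\<^sub>R x = x"
    by (transfer, simp add: algebra_simps)+
  show "dist x y = norm (x - y)" by (rule dist_ell2_def)
  show "sgn x = inverse (norm x) *\<^sub>R x" by (rule sgn_ell2_def)
  show "uniformity = (INF e\<in>{0 <..}. principal {(x, y :: ell2). dist x y < e})"
    by (rule uniformity_ell2_def)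
  show "open U = (\<forall>x\<in>U. \<forall>\<^sub>F (x', y) in uniformity. x' = x \<longrightarrow> y \<in> U)" for U :: "ell2 set"
    by (rule open_ell2_def)
  show "norm x = 0 \<longleftrightarrow> x = 0"
    by transfer (auto simp: suminf_eq_zero_iff)
  show "norm (x + y) \<le> norm x + norm y" by transfer (rule ell2_add)
  show "norm (r *\<^sub>R x) = \<bar>r\<bar> * norm x" by transfer (rule ell2_scaleR)
  show "c *\<^sub>C (x + y) = c *\<^sub>C x + c *\<^sub>C y" "(c + d) *\<^sub>C x = c *\<^sub>C x + d *\<^sub>C x"
    "c *\<^sub>C d *\<^sub>C x = (c * d) *\<^sub>C x" "complex_of_real r *\<^sub>C x = r *\<^sub>R x"
    by (transfer, simp add: algebra_simps scaleR_conv_of_real)+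
  show "norm (c *\<^sub>C x) = cmod c * norm x" by transfer (rule ell2_scale)
qed

end

lemma L2_set_le_norm_ell2: "L2_set (\<lambda>i. cmod (ell2_apply x i)) {..<n} \<le> norm x"
  by transfer (rule L2_set_le_ell2)

lemma cmod_ell2_apply_le: "cmod (ell2_apply x n) \<le> norm x"
  using order_trans[OF member_le_L2_set[of "{..<Suc n}" n "\<lambda>i. cmod (ell2_apply x i)"]
      L2_set_le_norm_ell2[of x "Suc n"]] by simp

lemma ell2_cinner_summable:
  assumes "summable (\<lambda>n. (cmod (f n))\<^sup>2)" "summable (\<lambda>n. (cmod (g n))\<^sup>2)"
  shows "summable (\<lambda>n. f n * cnj (g n))"
proof (rule summable_comparison_test')
  show "summable (\<lambda>n. (cmod (f n))\<^sup>2 + (cmod (g n))\<^sup>2)"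
    by (intro summable_add assms)
  show "norm (f n * cnj (g n)) \<le> (cmod (f n))\<^sup>2 + (cmod (g n))\<^sup>2" for n
  proof -
    have "0 \<le> cmod (f n) * cmod (g n)" by simp
    then show ?thesis
      using sum_squares_bound[of "cmod (f n)" "cmod (g n)"] by (simp only: norm_mult complex_mod_cnj)
  qed
qed

instantiation ell2 :: chilbert_space
begin

lift_definition cinner_ell2 :: "ell2 \<Rightarrow> ell2 \<Rightarrow> complex" is "\<lambda>f g. \<Sum>n. f n * cnj (g n)" .

instance
proof
  fix x y z :: ell2 and c :: complex
  show "cinner x y = cnj (cinner y x)"
    by transfer (simp add: bounded_linear.suminf[OF bounded_linear_cnj ell2_cinner_summable] mult.commute)
  show "cinner (x + y) z = cinner x z + cinner y z"
    by transfer (simp add: distrib_right suminf_add[OF ell2_cinner_summable ell2_cinner_summable])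
  show "cinner (c *\<^sub>C x) y = c * cinner x y"
    by transfer (simp add: mult.assoc suminf_mult[OF ell2_cinner_summable])
  show "cinner x x = complex_of_real ((norm x)\<^sup>2)"
  proof -
    have "(norm x)\<^sup>2 = (\<Sum>n. (cmod (ell2_apply x n))\<^sup>2)"
      by (simp add: norm_ell2.rep_eq suminf_nonneg ell2_summable)
    moreover have "complex_of_real (\<Sum>n. (cmod (ell2_apply x n))\<^sup>2) =
        (\<Sum>n. complex_of_real ((cmod (ell2_apply x n))\<^sup>2))"
      by (intro suminf_of_real ell2_summable)
    ultimately show ?thesis
      by (simp only: complex_norm_square cinner_ell2.rep_eq)
  qed
next
  fix X :: "nat \<Rightarrow> ell2"
  assume X: "Cauchy X"
  have "Cauchy (\<lambda>m. ell2_apply (X m) i)" for i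
  proof (rule metric_CauchyI)
    fix e :: real assume "e > 0"
    then obtain N where N: "\<And>m n. m \<ge> N \<Longrightarrow> n \<ge> N \<Longrightarrow> dist (X m) (X n) < e"
      using X metric_CauchyD by blast
    have "dist (ell2_apply (X m) i) (ell2_apply (X n) i) \<le> dist (X m) (X n)" for m n
      using cmod_ell2_apply_le[of "X m - X n" i] by (simp add: dist_norm minus_ell2.rep_eq)
    then show "\<exists>N. \<forall>m\<ge>N. \<forall>n\<ge>N. dist (ell2_apply (X m) i) (ell2_apply (X n) i) < e"
      using N order_le_less_trans by blast
  qed
  then have "\<exists>l. (\<lambda>m. ell2_apply (X m) i) \<longlonglongrightarrow> l" for i
    using Cauchy_convergent_iff convergent_def by blast
  then obtain f where f: "\<And>i. (\<lambda>m. ell2_apply (X m) i) \<longlonglongrightarrow> f i" by metis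
  have bound: "L2_set (\<lambda>i. cmod (ell2_apply (X m) i - f i)) {..<k} \<le> e"
    if "\<And>n. n \<ge> N \<Longrightarrow> dist (X m) (X n) \<le> e" for m N k e
  proof (rule LIMSEQ_le_const2)
    show "(\<lambda>n. L2_set (\<lambda>i. cmod (ell2_apply (X m) i - ell2_apply (X n) i)) {..<k})
        \<longlonglongrightarrow> L2_set (\<lambda>i. cmod (ell2_apply (X m) i - f i)) {..<k}"
      unfolding L2_set_def by (intro tendsto_intros f)
    show "\<exists>N. \<forall>n\<ge>N. L2_set (\<lambda>i. cmod (ell2_apply (X m) i - ell2_apply (X n) i)) {..<k} \<le> e"
    proof (intro exI allI impI)
      fix n assume "n \<ge> N"
      then have "norm (X m - X n) \<le> e" using that by (simp add: dist_norm)
      then show "L2_set (\<lambda>i. cmod (ell2_apply (X m) i - ell2_apply (X n) i)) {..<k} \<le> e"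
        using L2_set_le_norm_ell2[of "X m - X n" k] by (simp add: minus_ell2.rep_eq)
    qed
  qed
  obtain M where M: "\<And>m n. m \<ge> M \<Longrightarrow> n \<ge> M \<Longrightarrow> dist (X m) (X n) < 1"
    using X metric_CauchyD[of X 1] by auto
  have "summable (\<lambda>i. (cmod (ell2_apply (X M) i - f i))\<^sup>2)"
    by (rule ell2_bound(1), rule bound[where N=M]) (use M less_imp_le in blast)
  then have "summable (\<lambda>i. (cmod (ell2_apply (X M) i + - (ell2_apply (X M) i - f i)))\<^sup>2)"
    by (intro ell2_add ell2_summable) (simp add: norm_minus_commute)
  then have fs: "summable (\<lambda>i. (cmod (f i))\<^sup>2)" by simp
  have fa: "ell2_apply (Ell2 f) = f" using fs by (simp add: Ell2_inverse)
  have "X \<longlonglongrightarrow> Ell2 f"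
  proof (rule metric_LIMSEQ_I)
    fix e :: real assume e: "e > 0"
    then obtain N where N: "\<And>m n. m \<ge> N \<Longrightarrow> n \<ge> N \<Longrightarrow> dist (X m) (X n) < e/2"
      using X metric_CauchyD[of X "e/2"] by auto
    have "norm (X m - Ell2 f) \<le> e/2" if "m \<ge> N" for m
    proof -
      have "L2_set (\<lambda>i. cmod (ell2_apply (X m) i - f i)) {..<k} \<le> e/2" for k
        by (rule bound[where N=N]) (use N that less_imp_le in blast)
      from ell2_bound(2)[OF this] show ?thesis
        by (simp add: norm_ell2.rep_eq minus_ell2.rep_eq fa)
    qed
    then show "\<exists>N. \<forall>m\<ge>N. dist (X m) (Ell2 f) < e"
      using e by (force simp: dist_norm)
  qed
  then show "convergent X" by (auto simp: convergent_def)
qed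

end

end

theory Submission
  imports Defs
begin

text \<open>Let \<open>s\<^sub>i = weight i = 1 / (i + 1)\<close>, and split the Hilbert space into four-dimensional blocks,
  the \<open>i\<close>-th with basis \<open>u, u', w, w'\<close>.  For convergent sequences \<open>f \<longlonglongrightarrow> p\<close> and \<open>k \<longlonglongrightarrow> r\<close> and a
  scalar \<open>c\<close>, the operator \<open>tri_op f p k r c\<close> acts on the \<open>i\<close>-th block by
  \<open>u \<mapsto> p u + r w\<close>, \<open>u' \<mapsto> f\<^sub>i u' + s\<^sub>i k\<^sub>i w + k\<^sub>i w'\<close>, \<open>w \<mapsto> c w\<close>, \<open>w' \<mapsto> c w'\<close>.
  Thus the limits \<open>p\<close> and \<open>r\<close> are visible in every block, next to the \<open>i\<close>-th terms.  These operators
  form a closed unital algebra \<open>A\<close>: the product is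
  \<open>(f, k, c)(f', k', c') = (f f', k f' + c k', c c')\<close>, and the norm dominates \<open>\<bar>f\<^sub>i\<bar>\<close>, \<open>\<bar>k\<^sub>i\<bar>\<close> and
  \<open>\<bar>c\<bar>\<close>.

  The diagonal elements \<open>(f, 0, 0)\<close> are a copy of the algebra of convergent sequences, that is, of the
  continuous functions on the one-point compactification of the natural numbers.  A real function
  that is \<open>1\<close> at infinity and in \<open>[0,1)\<close> elsewhere peaks at infinity; its powers have as weak* limit
  a projection \<open>q\<close>, which is also the weak* limit of the tail indicators \<open>p\<^sub>N\<close>.

  Let \<open>b\<close> be the element with \<open>k = 1\<close> and \<open>f = 0\<close>, \<open>c = 0\<close>.  On the one hand,
  \<open>\<parallel>b p\<^sub>N\<parallel> \<le> 1 + s\<^sub>N\<close>, because the terms \<open>s\<^sub>i\<close> with \<open>i < N\<close> are cut off; so \<open>\<parallel>b q\<parallel> \<le> 1\<close>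
  (lemma \<open>norm_arens_limit_projection_le\<close>).  On the other hand, \<open>g q = b q\<close> forces the sequence
  \<open>k\<close> of \<open>g\<close> to have limit \<open>1\<close> (lemma \<open>limit_entry_determined\<close>).  The row of \<open>g\<close> for \<open>w\<close> in the
  \<open>i\<close>-th block then starts with \<open>(1, s\<^sub>i k\<^sub>i)\<close>, and \<open>\<parallel>g\<parallel> \<le> 1\<close> leaves no room for a second nonzero
  entry: \<open>k\<^sub>i = 0\<close> for all \<open>i\<close> (lemma \<open>row_forces_zero\<close>), which contradicts \<open>k \<longlonglongrightarrow> 1\<close>.  The norm
  \<open>1\<close> is approached along the tail indicators but not attained, because every \<open>s\<^sub>i\<close> is positive although
  \<open>s\<^sub>i \<longlonglongrightarrow> 0\<close>.  The entries \<open>k\<^sub>i\<close> in the \<open>w'\<close> row are there to make the norm control \<open>k\<close>; with the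
  entries \<open>s\<^sub>i k\<^sub>i\<close> alone the algebra would not be closed.\<close>

section \<open>Bounded operators and diagonal operators on square-summable sequences\<close>

lemma cblinfun_apply_CBlinfun: "bounded_clinear f \<Longrightarrow> cblinfun_apply (CBlinfun f) = f"
  by (simp add: CBlinfun_inverse)

lemma bounded_linear_cblinfun_apply: "bounded_linear (cblinfun_apply T)"
  by transfer (simp add: bounded_clinear_def)

lemmas cblinfun_apply_sum = linear_sum[OF bounded_linear.linear[OF bounded_linear_cblinfun_apply]]
lemmas tendsto_cblinfun_apply = bounded_linear.tendsto[OF bounded_linear_cblinfun_apply]

lemma ell2_norm_sq: "(norm x)\<^sup>2 = (\<Sum>n. (cmod (ell2_apply x n))\<^sup>2)"
  by (simp add: norm_ell2.rep_eq suminf_nonneg ell2_summable)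

lemma ell2_dominated:
  assumes "\<And>n. cmod (f n) \<le> C * cmod (ell2_apply x n)" and "0 \<le> C"
  shows "ell2_apply (Ell2 f) = f" and "norm (Ell2 f) \<le> C * norm x"
proof -
  have sq: "(cmod (f n))\<^sup>2 \<le> C\<^sup>2 * (cmod (ell2_apply x n))\<^sup>2" for n
    using power_mono[OF assms(1)[of n], of 2] by (simp add: power_mult_distrib)
  have sC: "summable (\<lambda>n. C\<^sup>2 * (cmod (ell2_apply x n))\<^sup>2)"
    by (intro summable_mult ell2_summable)
  have sf: "summable (\<lambda>n. (cmod (f n))\<^sup>2)"
    by (rule summable_comparison_test'[OF sC, of 0]) (simp only: real_norm_def abs_power2 sq)
  then show ap: "ell2_apply (Ell2 f) = f" by (rule Ell2_inverse[OF CollectI])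
  have "(norm (Ell2 f))\<^sup>2 \<le> (\<Sum>n. C\<^sup>2 * (cmod (ell2_apply x n))\<^sup>2)"
    unfolding ell2_norm_sq ap by (rule suminf_le[OF sq sf sC])
  also have "\<dots> = (C * norm x)\<^sup>2"
    unfolding power_mult_distrib ell2_norm_sq[of x] by (rule suminf_mult[OF ell2_summable])
  finally show "norm (Ell2 f) \<le> C * norm x"
    by (rule power2_le_imp_le) (simp add: assms(2))
qed

definition diag_op :: "(nat \<Rightarrow> complex) \<Rightarrow> (ell2 \<Rightarrow>\<^sub>C\<^sub>L ell2)"
  where "diag_op d = CBlinfun (\<lambda>x. Ell2 (\<lambda>n. d n * ell2_apply x n))"

lemma
  assumes "\<And>n. cmod (d n) \<le> C"
  shows diag_op_apply: "ell2_apply (cblinfun_apply (diag_op d) x) n = d n * ell2_apply x n"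
    and norm_diag_op: "norm (diag_op d) \<le> C"
proof -
  have C: "0 \<le> C" using order_trans[OF norm_ge_zero assms] .
  have le: "cmod (d n * ell2_apply x n) \<le> C * cmod (ell2_apply x n)" for x n
    using assms by (simp add: norm_mult mult_right_mono)
  note dom = ell2_dominated[OF le C]
  have "bounded_clinear (\<lambda>x. Ell2 (\<lambda>n. d n * ell2_apply x n))"
  proof (rule bounded_clinearI[where K=C])
    show "norm (Ell2 (\<lambda>n. d n * ell2_apply x n)) \<le> C * norm x" for x by (rule dom)
    show "Ell2 (\<lambda>n. d n * ell2_apply (x + y) n) =
        Ell2 (\<lambda>n. d n * ell2_apply x n) + Ell2 (\<lambda>n. d n * ell2_apply y n)" for x y
      by (rule ell2_eqI) (simp only: dom plus_ell2.rep_eq[of "Ell2 _"], simp only: plus_ell2.rep_eq distrib_left)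
    show "Ell2 (\<lambda>n. d n * ell2_apply (c *\<^sub>C x) n) = c *\<^sub>C Ell2 (\<lambda>n. d n * ell2_apply x n)" for c x
      by (rule ell2_eqI) (simp only: dom scaleC_ell2.rep_eq[of _ "Ell2 _"], simp add: scaleC_ell2.rep_eq)
  qed
  then have ap: "cblinfun_apply (diag_op d) x = Ell2 (\<lambda>n. d n * ell2_apply x n)" for x
    by (simp add: diag_op_def cblinfun_apply_CBlinfun)
  show "ell2_apply (cblinfun_apply (diag_op d) x) n = d n * ell2_apply x n"
    by (simp only: ap dom)
  show "norm (diag_op d) \<le> C"
    by (rule norm_cblinfun_bound[OF C]) (simp only: ap dom)
qed

definition shift_op :: "ell2 \<Rightarrow>\<^sub>C\<^sub>L ell2"
  where "shift_op = CBlinfun (\<lambda>x. Ell2 (\<lambda>n. if n = 0 then 0 else ell2_apply x (n - 1)))"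

lemma
  shows shift_op_apply:
      "ell2_apply (cblinfun_apply shift_op x) n = (if n = 0 then 0 else ell2_apply x (n - 1))"
    and norm_shift_op: "norm shift_op \<le> 1"
proof -
  define f where "f x n = (if n = 0 then 0 else ell2_apply x (n - 1))" for x n
  have sm: "summable (\<lambda>n. (cmod (f x n))\<^sup>2)" for x
    by (rule summable_Suc_iff[THEN iffD1]) (simp add: f_def ell2_summable)
  have e: "ell2_apply (Ell2 (f x)) = f x" for x
    using sm by (simp add: Ell2_inverse)
  have nm: "norm (Ell2 (f x)) = norm x" for x
  proof -
    have "(norm (Ell2 (f x)))\<^sup>2 = (\<Sum>n. (cmod (f x (Suc n)))\<^sup>2) + (cmod (f x 0))\<^sup>2"
      unfolding ell2_norm_sq e by (simp add: suminf_split_head[OF sm])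
    then have "(norm (Ell2 (f x)))\<^sup>2 = (norm x)\<^sup>2"
      by (simp add: f_def ell2_norm_sq)
    then show ?thesis by (rule power2_eq_imp_eq) simp_all
  qed
  have "bounded_clinear (\<lambda>x. Ell2 (f x))"
  proof (rule bounded_clinearI[where K=1])
    show "Ell2 (f (x + y)) = Ell2 (f x) + Ell2 (f y)" for x y
      by (rule ell2_eqI) (simp only: e plus_ell2.rep_eq, simp add: f_def plus_ell2.rep_eq)
    show "Ell2 (f (c *\<^sub>C x)) = c *\<^sub>C Ell2 (f x)" for c x
      by (rule ell2_eqI) (simp only: e scaleC_ell2.rep_eq, simp add: f_def scaleC_ell2.rep_eq)
    show "norm (Ell2 (f x)) \<le> 1 * norm x" for x by (simp only: nm mult_1_left order_refl)
  qed
  then have ap: "cblinfun_apply shift_op x = Ell2 (f x)" for x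
    unfolding shift_op_def f_def by (rule cblinfun_apply_CBlinfun[THEN fun_cong])
  show "ell2_apply (cblinfun_apply shift_op x) n = (if n = 0 then 0 else ell2_apply x (n - 1))"
    unfolding ap e f_def ..
  show "norm shift_op \<le> 1" by (rule norm_cblinfun_bound) (simp_all only: ap nm mult_1_left order_refl zero_le_one)
qed

definition ket :: "nat \<Rightarrow> ell2"
  where "ket j = Ell2 (\<lambda>n. if n = j then 1 else 0)"

lemma ket_apply: "ell2_apply (ket j) n = (if n = j then 1 else 0)"
proof -
  have "summable (\<lambda>n. (cmod (if n = j then 1 else 0))\<^sup>2)"
    by (rule summable_finite[of "{j}"]) auto
  then show ?thesis by (simp add: ket_def Ell2_inverse)
qed

lemma cinner_ket_right: "cinner x (ket j) = ell2_apply x j"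
proof -
  have "(\<lambda>n. ell2_apply x n * cnj (ell2_apply (ket j) n)) sums
      (\<Sum>n\<in>{j}. ell2_apply x n * cnj (ell2_apply (ket j) n))"
    by (rule sums_finite) (auto simp: ket_apply)
  then show ?thesis by (simp add: cinner_ell2.rep_eq sums_iff ket_apply)
qed

lemma norm_ket: "norm (ket j) = 1"
proof -
  have "cinner (ket j) (ket j) = 1"
    by (simp add: cinner_ket_right ket_apply)
  then have "(norm (ket j))\<^sup>2 = 1"
    unfolding cinner_self using of_real_eq_1_iff by blast
  then show ?thesis
    using power2_eq_imp_eq[of "norm (ket j)" 1] by simp
qed

lemma cmod_entry_le: "cmod (ell2_apply (cblinfun_apply T (ket j)) m) \<le> norm T"
  using order_trans[OF cmod_ell2_apply_le norm_cblinfun, of T "ket j" m]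
  unfolding norm_ket mult_1_right .

section \<open>The algebra\<close>

text \<open>The properties that matter are \<open>weight i > 0\<close>, which excludes a contractive lift, and
  \<open>weight i \<longlonglongrightarrow> 0\<close>, which makes the norm at infinity equal to \<open>1\<close>.\<close>

definition weight :: "nat \<Rightarrow> real"
  where "weight i = 1 / real (Suc i)"

text \<open>The basis vectors \<open>u, u', w, w'\<close> of the \<open>i\<close>-th block have the indices \<open>4 i, \<dots>, 4 i + 3\<close>.  An entry
  from \<open>u\<close> to \<open>w\<close> or from \<open>u'\<close> to \<open>w'\<close> moves the index by two, the one from \<open>u'\<close> to \<open>w\<close> by one, so
  each of the three summands is a diagonal operator after a power of the shift.  Its norm is at
  most the sum of the three suprema.\<close>

definition tri_op ::
  "(nat \<Rightarrow> complex) \<Rightarrow> complex \<Rightarrow> (nat \<Rightarrow> complex) \<Rightarrow> complex \<Rightarrow> complex \<Rightarrow> (ell2 \<Rightarrow>\<^sub>C\<^sub>L ell2)"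
  where "tri_op f p k r c =
    diag_op (\<lambda>m. if m mod 4 = 0 then p else if m mod 4 = 1 then f (m div 4) else c)
    + diag_op (\<lambda>m. if m mod 4 = 2 then r else if m mod 4 = 3 then k (m div 4) else 0)
        o\<^sub>C (shift_op o\<^sub>C shift_op)
    + diag_op (\<lambda>m. if m mod 4 = 2 then complex_of_real (weight (m div 4)) * k (m div 4) else 0) o\<^sub>C shift_op"

lemma weight_pos: "0 < weight i" and weight_le_1: "weight i \<le> 1"
  by (simp_all add: weight_def)

lemma weight_tendsto_0: "weight \<longlonglongrightarrow> 0"
  using LIMSEQ_inverse_real_of_nat by (simp add: weight_def[abs_def] inverse_eq_divide)

lemma norm_tri_op:
  assumes "\<And>i. cmod (f i) \<le> A" "cmod p \<le> A" "cmod c \<le> A"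
    and "\<And>i. cmod (k i) \<le> B" "cmod r \<le> B"
    and "\<And>i. weight i * cmod (k i) \<le> W"
  shows "norm (tri_op f p k r c) \<le> A + B + W"
proof -
  have nonneg: "0 \<le> B" "0 \<le> W"
    using order_trans[OF norm_ge_zero assms(5)] order_trans[OF _ assms(6)[of 0]]
    by (auto simp: weight_def)
  have le: "norm (diag_op d o\<^sub>C S) \<le> D" if "\<And>m. cmod (d m) \<le> D" "norm S \<le> 1" for d D and S :: "ell2 \<Rightarrow>\<^sub>C\<^sub>L ell2"
  proof -
    have "norm (diag_op d o\<^sub>C S) \<le> norm (diag_op d) * norm S" by (rule norm_cblinfun_compose)
    also have "\<dots> \<le> D * 1"
      using order_trans[OF norm_ge_zero that(1)] that
      by (intro mult_mono norm_diag_op) auto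
    finally show ?thesis by simp
  qed
  have ss: "norm (shift_op o\<^sub>C shift_op) \<le> 1"
    using order_trans[OF norm_cblinfun_compose mult_mono[OF norm_shift_op norm_shift_op]] by simp
  show ?thesis
    unfolding tri_op_def
    by (intro norm_triangle_le add_mono le norm_diag_op ss norm_shift_op)
      (use assms nonneg in \<open>auto simp: norm_mult abs_of_pos[OF weight_pos]\<close>)
qed

lemma tri_op_coords:
  assumes "Bseq f" "Bseq k"
  shows "ell2_apply (cblinfun_apply (tri_op f p k r c) x) (4 * i) = p * ell2_apply x (4 * i)"
    and "ell2_apply (cblinfun_apply (tri_op f p k r c) x) (4 * i + 1) = f i * ell2_apply x (4 * i + 1)"
    and "ell2_apply (cblinfun_apply (tri_op f p k r c) x) (4 * i + 2) =
      r * ell2_apply x (4 * i) + complex_of_real (weight i) * k i * ell2_apply x (4 * i + 1) + c * ell2_apply x (4 * i + 2)"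
    and "ell2_apply (cblinfun_apply (tri_op f p k r c) x) (4 * i + 3) =
      k i * ell2_apply x (4 * i + 1) + c * ell2_apply x (4 * i + 3)"
proof -
  obtain F K where F: "\<And>i. cmod (f i) \<le> F" and K: "\<And>i. cmod (k i) \<le> K" and "F > 0" "K > 0"
    using assms by (metis BseqE)
  have wk: "weight i * cmod (k i) \<le> K" for i
    using mult_mono[OF weight_le_1 K] \<open>K > 0\<close> by simp
  have 1: "ell2_apply (cblinfun_apply (diag_op (\<lambda>m. if m mod 4 = 0 then p else if m mod 4 = 1 then f (m div 4) else c)) x) m
      = (if m mod 4 = 0 then p else if m mod 4 = 1 then f (m div 4) else c) * ell2_apply x m" for x m
    by (rule diag_op_apply[where C="F + cmod p + cmod c"])
      (smt (verit) F norm_ge_zero)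
  have 2: "ell2_apply (cblinfun_apply (diag_op (\<lambda>m. if m mod 4 = 2 then r else if m mod 4 = 3 then k (m div 4) else 0)) x) m
      = (if m mod 4 = 2 then r else if m mod 4 = 3 then k (m div 4) else 0) * ell2_apply x m" for x m
    by (rule diag_op_apply[where C="K + cmod r"])
      (use K \<open>K > 0\<close> in \<open>auto intro: add_increasing2 add_increasing\<close>)
  have 3: "ell2_apply (cblinfun_apply (diag_op (\<lambda>m. if m mod 4 = 2 then complex_of_real (weight (m div 4)) * k (m div 4) else 0)) x) m
      = (if m mod 4 = 2 then complex_of_real (weight (m div 4)) * k (m div 4) else 0) * ell2_apply x m" for x m
    by (rule diag_op_apply[where C=K])
      (use wk \<open>K > 0\<close> weight_pos in \<open>auto simp: norm_mult less_imp_le abs_of_pos\<close>)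
  note * = tri_op_def plus_cblinfun.rep_eq plus_ell2.rep_eq cblinfun_compose.rep_eq shift_op_apply 1 2 3
  have r: "(4 * i) mod 4 = 0" "(4 * i + 1) mod 4 = 1" "(4 * i + 2) mod 4 = 2" "(4 * i + 3) mod 4 = 3"
    by presburger+
  have s: "(4 * i) div 4 = i" "(4 * i + 1) div 4 = i" "(4 * i + 2) div 4 = i" "(4 * i + 3) div 4 = i"
    "4 * i + 2 - 1 = 4 * i + 1" "4 * i + 1 - 1 = 4 * i" "4 * i + 3 - 1 = 4 * i + 2"
    by simp_all
  show "ell2_apply (cblinfun_apply (tri_op f p k r c) x) (4 * i) = p * ell2_apply x (4 * i)"
    "ell2_apply (cblinfun_apply (tri_op f p k r c) x) (4 * i + 1) = f i * ell2_apply x (4 * i + 1)"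
    "ell2_apply (cblinfun_apply (tri_op f p k r c) x) (4 * i + 2) =
      r * ell2_apply x (4 * i) + complex_of_real (weight i) * k i * ell2_apply x (4 * i + 1) + c * ell2_apply x (4 * i + 2)"
    "ell2_apply (cblinfun_apply (tri_op f p k r c) x) (4 * i + 3) =
      k i * ell2_apply x (4 * i + 1) + c * ell2_apply x (4 * i + 3)"
    unfolding * r s by simp_all
qed

lemma mod4_cases:
  fixes P :: "nat \<Rightarrow> bool"
  assumes "\<And>i. P (4 * i)" "\<And>i. P (4 * i + 1)" "\<And>i. P (4 * i + 2)" "\<And>i. P (4 * i + 3)"
  shows "P n"
proof -
  have "n mod 4 = 0 \<or> n mod 4 = 1 \<or> n mod 4 = 2 \<or> n mod 4 = 3" by linarith
  moreover have "n = 4 * (n div 4) + n mod 4" by simp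
  ultimately show ?thesis
    using assms by (metis add.right_neutral)
qed

lemma tri_op_eqI:
  assumes "Bseq f" "Bseq k"
    and "\<And>x i. ell2_apply (cblinfun_apply T x) (4 * i) = p * ell2_apply x (4 * i)"
    and "\<And>x i. ell2_apply (cblinfun_apply T x) (4 * i + 1) = f i * ell2_apply x (4 * i + 1)"
    and "\<And>x i. ell2_apply (cblinfun_apply T x) (4 * i + 2) =
      r * ell2_apply x (4 * i) + complex_of_real (weight i) * k i * ell2_apply x (4 * i + 1) + c * ell2_apply x (4 * i + 2)"
    and "\<And>x i. ell2_apply (cblinfun_apply T x) (4 * i + 3) =
      k i * ell2_apply x (4 * i + 1) + c * ell2_apply x (4 * i + 3)"
  shows "T = tri_op f p k r c"
  by (rule cblinfun_eqI, rule ell2_eqI, rule mod4_cases) (simp_all only: assms(3-6) tri_op_coords[OF assms(1,2)])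

lemma
  fixes f g :: "nat \<Rightarrow> complex"
  assumes "Bseq f" "Bseq g"
  shows Bseq_mult_pointwise: "Bseq (\<lambda>i. f i * g i)"
    and Bseq_add_pointwise: "Bseq (\<lambda>i. f i + g i)"
proof -
  obtain F G where "\<And>i. cmod (f i) \<le> F" "\<And>i. cmod (g i) \<le> G" "F > 0"
    using assms by (metis BseqE)
  then show "Bseq (\<lambda>i. f i * g i)" "Bseq (\<lambda>i. f i + g i)"
    by (auto intro: BseqI'[of _ "F * G"] BseqI'[of _ "F + G"] simp: norm_mult mult_mono norm_triangle_mono)
qed

lemma tri_op_compose:
  assumes "Bseq f" "Bseq k" "Bseq f'" "Bseq k'"
  shows "tri_op f p k r c o\<^sub>C tri_op f' p' k' r' c' =
    tri_op (\<lambda>i. f i * f' i) (p * p') (\<lambda>i. k i * f' i + c * k' i) (r * p' + c * r') (c * c')"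
  by (rule tri_op_eqI)
    (use assms in \<open>simp_all only: cblinfun_compose.rep_eq tri_op_coords Bseq_mult_pointwise Bseq_add_pointwise Bseq_mult_pointwise[OF Bfun_const]\<close>,
      simp_all add: algebra_simps)

lemma tri_op_add:
  assumes "Bseq f" "Bseq k" "Bseq f'" "Bseq k'"
  shows "tri_op f p k r c + tri_op f' p' k' r' c' =
    tri_op (\<lambda>i. f i + f' i) (p + p') (\<lambda>i. k i + k' i) (r + r') (c + c')"
  by (rule tri_op_eqI)
    (use assms in \<open>simp_all only: plus_cblinfun.rep_eq plus_ell2.rep_eq tri_op_coords Bseq_add_pointwise\<close>,
      simp_all add: algebra_simps)

lemma tri_op_scaleC:
  assumes "Bseq f" "Bseq k"
  shows "z *\<^sub>C tri_op f p k r c = tri_op (\<lambda>i. z * f i) (z * p) (\<lambda>i. z * k i) (z * r) (z * c)"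
  by (rule tri_op_eqI)
    (use assms in \<open>simp_all only: scaleC_cblinfun.rep_eq scaleC_ell2.rep_eq tri_op_coords Bseq_mult_pointwise[OF Bfun_const]\<close>,
      simp_all add: algebra_simps)

lemma id_eq_tri_op: "id_cblinfun = tri_op (\<lambda>_. 1) 1 (\<lambda>_. 0) 0 1"
  by (rule tri_op_eqI) (simp_all add: id_cblinfun.rep_eq)

lemma zero_eq_tri_op: "0 = tri_op (\<lambda>_. 0) 0 (\<lambda>_. 0) 0 0"
  by (rule tri_op_eqI) (simp_all add: zero_cblinfun.rep_eq zero_ell2.rep_eq)

definition witness_algebra :: "(ell2 \<Rightarrow>\<^sub>C\<^sub>L ell2) set"
  where "witness_algebra = {tri_op f p k r c | f p k r c. f \<longlonglongrightarrow> p \<and> k \<longlonglongrightarrow> r}"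

lemma witness_algebraI: "f \<longlonglongrightarrow> p \<Longrightarrow> k \<longlonglongrightarrow> r \<Longrightarrow> tri_op f p k r c \<in> witness_algebra"
  unfolding witness_algebra_def by blast

lemma witness_algebraE:
  assumes "T \<in> witness_algebra"
  obtains f p k r c where "T = tri_op f p k r c" "f \<longlonglongrightarrow> p" "k \<longlonglongrightarrow> r" "Bseq f" "Bseq k"
proof -
  obtain f p k r c where "T = tri_op f p k r c" "f \<longlonglongrightarrow> p" "k \<longlonglongrightarrow> r"
    using assms unfolding witness_algebra_def by blast
  moreover from this have "Bseq f" "Bseq k"
    by (auto intro: convergent_imp_Bseq convergentI)
  ultimately show thesis by (rule that)
qed

abbreviation entry :: "(ell2 \<Rightarrow>\<^sub>C\<^sub>L ell2) \<Rightarrow> nat \<Rightarrow> nat \<Rightarrow> complex"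
  where "entry T m j \<equiv> ell2_apply (cblinfun_apply T (ket j)) m"

lemma tri_op_entries:
  assumes "Bseq f" "Bseq k"
  shows "entry (tri_op f p k r c) 0 0 = p" "entry (tri_op f p k r c) 2 0 = r"
    and "entry (tri_op f p k r c) 2 2 = c"
    and "entry (tri_op f p k r c) (4 * i + 1) (4 * i + 1) = f i"
    and "entry (tri_op f p k r c) (4 * i + 3) (4 * i + 1) = k i"
  using tri_op_coords[OF assms, of p r c "ket 0" 0] tri_op_coords[OF assms, of p r c "ket 2" 0]
    tri_op_coords[OF assms, of p r c "ket (4 * i + 1)" i]
  by (simp_all add: ket_apply numeral_2_eq_2)

lemma tendsto_ell2_apply_cblinfun:
  assumes "X \<longlonglongrightarrow> T"
  shows "(\<lambda>n. ell2_apply (cblinfun_apply (X n) x) m) \<longlonglongrightarrow> ell2_apply (cblinfun_apply T x) m"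
proof (rule LIM_zero_cancel, rule Lim_null_comparison[OF always_eventually])
  show "(\<lambda>n. norm (X n - T) * norm x) \<longlonglongrightarrow> 0"
    using tendsto_mult_left_zero[OF tendsto_norm_zero[OF LIM_zero[OF assms]]] .
  show "\<forall>n. norm (ell2_apply (cblinfun_apply (X n) x) m - ell2_apply (cblinfun_apply T x) m)
      \<le> norm (X n - T) * norm x"
    using order_trans[OF cmod_ell2_apply_le norm_cblinfun, of "X _ - T" x m]
    by (simp add: minus_cblinfun.rep_eq minus_ell2.rep_eq)
qed

text \<open>An entry of an operator is bounded by its norm, so norm convergence of \<open>X n\<close> is uniform over all
  entries, and limits along a sequence of entries can be interchanged with the limit in \<open>n\<close>.  This is
  what keeps \<open>f \<longlonglongrightarrow> p\<close> and \<open>k \<longlonglongrightarrow> r\<close> true in the closure of the algebra.\<close>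

lemma tendsto_limit_of_entries:
  assumes X: "X \<longlonglongrightarrow> T"
    and conv: "\<And>n. (\<lambda>i. entry (X n) (\<mu> i) (\<nu> i)) \<longlonglongrightarrow> entry (X n) m j"
  shows "(\<lambda>i. entry T (\<mu> i) (\<nu> i)) \<longlonglongrightarrow> entry T m j"
proof (rule swap_uniform_limit')
  show "\<forall>\<^sub>F n in sequentially. (\<lambda>i. entry (X n) (\<mu> i) (\<nu> i)) \<longlonglongrightarrow> entry (X n) m j"
    using conv by simp
  show "(\<lambda>n. entry (X n) m j) \<longlonglongrightarrow> entry T m j"
    by (rule tendsto_ell2_apply_cblinfun[OF X])
  show "uniform_limit UNIV (\<lambda>n i. entry (X n) (\<mu> i) (\<nu> i)) (\<lambda>i. entry T (\<mu> i) (\<nu> i)) sequentially"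
  proof (rule uniform_limitI)
    fix e :: real assume "e > 0"
    then have "\<forall>\<^sub>F n in sequentially. norm (X n - T) < e"
      using X by (simp add: tendsto_iff dist_norm)
    then show "\<forall>\<^sub>F n in sequentially. \<forall>i\<in>UNIV. dist (entry (X n) (\<mu> i) (\<nu> i)) (entry T (\<mu> i) (\<nu> i)) < e"
    proof eventually_elim
      case (elim n)
      have "dist (entry (X n) (\<mu> i) (\<nu> i)) (entry T (\<mu> i) (\<nu> i)) \<le> norm (X n - T)" for i
        using cmod_entry_le[of "X n - T" "\<nu> i" "\<mu> i"]
        by (simp add: dist_norm minus_cblinfun.rep_eq minus_ell2.rep_eq)
      then show ?case using elim order_le_less_trans by blast
    qed
  qed
qed simp_all

lemma closed_witness_algebra: "closed witness_algebra"
  unfolding closed_sequential_limits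
proof (intro allI impI, elim conjE)
  fix X T assume "\<forall>n. X n \<in> witness_algebra" and X: "X \<longlonglongrightarrow> T"
  then have "\<forall>n. \<exists>f p k r c. X n = tri_op f p k r c \<and> f \<longlonglongrightarrow> p \<and> k \<longlonglongrightarrow> r \<and> Bseq f \<and> Bseq k"
    by (meson witness_algebraE)
  then obtain f p k r c where rep: "\<And>n. X n = tri_op (f n) (p n) (k n) (r n) (c n)"
    and lim: "\<And>n. f n \<longlonglongrightarrow> p n" "\<And>n. k n \<longlonglongrightarrow> r n"
    and bs: "\<And>n. Bseq (f n)" "\<And>n. Bseq (k n)"
    by metis
  have en: "entry (X n) 0 0 = p n" "entry (X n) 2 0 = r n" "entry (X n) 2 2 = c n"
    "entry (X n) (4 * i + 1) (4 * i + 1) = f n i" "entry (X n) (4 * i + 3) (4 * i + 1) = k n i" for n i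
    unfolding rep by (rule tri_op_entries[OF bs])+
  define F K where "F i = entry T (4 * i + 1) (4 * i + 1)" and "K i = entry T (4 * i + 3) (4 * i + 1)" for i
  have F: "F \<longlonglongrightarrow> entry T 0 0"
    unfolding F_def using lim(1) by (intro tendsto_limit_of_entries[OF X]) (simp only: en)
  have K: "K \<longlonglongrightarrow> entry T 2 0"
    unfolding K_def using lim(2) by (intro tendsto_limit_of_entries[OF X]) (simp only: en)
  note lim_coord = tendsto_ell2_apply_cblinfun[OF X]
  have p: "p \<longlonglongrightarrow> entry T 0 0" and r: "r \<longlonglongrightarrow> entry T 2 0" and c: "c \<longlonglongrightarrow> entry T 2 2"
    using lim_coord[of "ket 0" 0] lim_coord[of "ket 0" 2] lim_coord[of "ket 2" 2]
    by (simp_all only: en)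
  have f: "(\<lambda>n. f n i) \<longlonglongrightarrow> F i" for i
    using lim_coord[of "ket (4 * i + 1)" "4 * i + 1"] unfolding en F_def .
  have k: "(\<lambda>n. k n i) \<longlonglongrightarrow> K i" for i
    using lim_coord[of "ket (4 * i + 1)" "4 * i + 3"] unfolding en K_def .
  have "T = tri_op F (entry T 0 0) K (entry T 2 0) (entry T 2 2)"
  proof (rule tri_op_eqI)
    show "Bseq F" "Bseq K" using F K by (auto intro: convergent_imp_Bseq convergentI)
  qed (rule LIMSEQ_unique[OF lim_coord], simp only: rep tri_op_coords[OF bs],
      intro tendsto_intros p r c f k)+
  then show "T \<in> witness_algebra"
    using F K witness_algebraI by metis
qed

lemma norm_id_ell2: "norm (id_cblinfun :: ell2 \<Rightarrow>\<^sub>C\<^sub>L ell2) = 1"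
proof (rule antisym)
  show "norm (id_cblinfun :: ell2 \<Rightarrow>\<^sub>C\<^sub>L ell2) \<le> 1"
    by (rule norm_cblinfun_bound) (simp_all add: id_cblinfun.rep_eq)
  show "1 \<le> norm (id_cblinfun :: ell2 \<Rightarrow>\<^sub>C\<^sub>L ell2)"
    using norm_cblinfun[of id_cblinfun "ket 0"] by (simp add: id_cblinfun.rep_eq norm_ket)
qed

lemma unital_operator_algebra_witness: "unital_operator_algebra witness_algebra"
proof -
  have "S + T \<in> witness_algebra" "S o\<^sub>C T \<in> witness_algebra"
    if "S \<in> witness_algebra" "T \<in> witness_algebra" for S T
    using that
    by (auto elim!: witness_algebraE simp: tri_op_add tri_op_compose intro!: witness_algebraI tendsto_intros)
  moreover have "z *\<^sub>C T \<in> witness_algebra" if "T \<in> witness_algebra" for z T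
    using that
    by (auto elim!: witness_algebraE simp: tri_op_scaleC intro!: witness_algebraI tendsto_intros)
  moreover have "0 \<in> witness_algebra" "id_cblinfun \<in> witness_algebra"
    unfolding zero_eq_tri_op id_eq_tri_op by (auto intro!: witness_algebraI)
  moreover have "id_cblinfun o\<^sub>C T = T" "T o\<^sub>C id_cblinfun = T" for T :: "ell2 \<Rightarrow>\<^sub>C\<^sub>L ell2"
    by (rule cblinfun_eqI, simp add: cblinfun_compose.rep_eq id_cblinfun.rep_eq)+
  ultimately show ?thesis
    unfolding unital_operator_algebra_def operator_algebra_def
    by (intro conjI ballI allI bexI[of _ id_cblinfun] closed_witness_algebra norm_id_ell2)
qed

section \<open>Weak* limits of multiplication operators\<close>

abbreviation mult_op :: "(nat \<Rightarrow> complex) \<Rightarrow> complex \<Rightarrow> (ell2 \<Rightarrow>\<^sub>C\<^sub>L ell2)"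
  where "mult_op f p \<equiv> tri_op f p (\<lambda>_. 0) 0 0"

text \<open>The \<open>i\<close>-th minimal idempotent of the algebra of convergent sequences.\<close>

abbreviation atom :: "nat \<Rightarrow> (ell2 \<Rightarrow>\<^sub>C\<^sub>L ell2)"
  where "atom i \<equiv> mult_op (\<lambda>j. if j = i then 1 else 0) 0"

lemma norm_mult_op: "(\<And>i. cmod (f i) \<le> C) \<Longrightarrow> cmod p \<le> C \<Longrightarrow> norm (mult_op f p) \<le> C"
  using norm_tri_op[of f C p 0 "\<lambda>_. 0" 0 0 0] order_trans[OF norm_ge_zero, of p C] by simp

lemma
  assumes "Bseq f"
  shows Bseq_if: "Bseq (\<lambda>i. if P i then f i else (0::complex))"
    and Bseq_if_not: "Bseq (\<lambda>i. if P i then (0::complex) else f i)"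
proof -
  obtain K where "\<And>i. cmod (f i) \<le> K" "K > 0"
    using assms by (metis BseqE)
  then show "Bseq (\<lambda>i. if P i then f i else 0)" "Bseq (\<lambda>i. if P i then 0 else f i)"
    by (auto intro!: BseqI'[of _ K])
qed

lemma mult_op_add:
  "Bseq f \<Longrightarrow> Bseq g \<Longrightarrow> mult_op f p + mult_op g r = mult_op (\<lambda>i. f i + g i) (p + r)"
  using tri_op_add[of f "\<lambda>_. 0" g "\<lambda>_. 0" p 0 0 r 0 0] by simp

lemma mult_op_scaleC: "Bseq f \<Longrightarrow> z *\<^sub>C mult_op f p = mult_op (\<lambda>i. z * f i) (z * p)"
  using tri_op_scaleC[of f "\<lambda>_. 0" z p 0 0] by simp

lemma Bseq_atom: "Bseq (\<lambda>j. if j = i then 1 else (0::complex))"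
  by (rule Bseq_if) simp

lemma mult_op_finite:
  assumes "Bseq z"
  shows "mult_op (\<lambda>i. if i < n then z i else 0) 0 = (\<Sum>i<n. z i *\<^sub>C atom i)"
proof (induction n)
  case 0
  then show ?case by (simp flip: zero_eq_tri_op)
next
  case (Suc n)
  have "(\<lambda>i. if i < Suc n then z i else 0) = (\<lambda>i. (if i < n then z i else 0) + z n * (if i = n then 1 else 0))"
    by (auto simp: fun_eq_iff less_Suc_eq)
  then have "mult_op (\<lambda>i. if i < Suc n then z i else 0) 0
      = mult_op (\<lambda>i. if i < n then z i else 0) 0 + z n *\<^sub>C atom n"
    by (simp add: mult_op_add mult_op_scaleC Bseq_if Bseq_atom assms Bseq_mult_pointwise)
  then show ?case by (simp add: Suc.IH)
qed

lemma cnj_sgn_mult_self: "cnj (sgn w) * w = complex_of_real (cmod w)"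
proof (cases "w = 0")
  case False
  have "w * cnj w = complex_of_real (cmod w) * complex_of_real (cmod w)"
    using complex_norm_square[of w] by (simp add: power2_eq_square)
  then show ?thesis using False by (simp add: sgn_eq field_simps)
qed simp

text \<open>A functional on the convergent sequences restricts to a summable sequence on the null sequences:
  after multiplication of each atom by a phase, the partial sums of the absolute values are values
  of the functional on the unit ball.\<close>

lemma summable_functional_atoms:
  fixes \<phi> :: "ell2 op_dual"
  shows "summable (\<lambda>i. cmod (cblinfun_apply \<phi> (atom i)))"
proof (rule bounded_imp_summable)
  fix n
  define z where "z i = cnj (sgn (cblinfun_apply \<phi> (atom i)))" for i
  have z1: "cmod (z i) \<le> 1" for i by (simp add: z_def norm_sgn)
  then have bz: "Bseq z" by (rule BseqI')
  have "complex_of_real (\<Sum>i<Suc n. cmod (cblinfun_apply \<phi> (atom i)))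
      = (\<Sum>i<Suc n. z i * cblinfun_apply \<phi> (atom i))"
    unfolding of_real_sum
    by (simp only: z_def cnj_sgn_mult_self)
  also have "\<dots> = cblinfun_apply \<phi> (mult_op (\<lambda>i. if i < Suc n then z i else 0) 0)"
    by (simp only: mult_op_finite[OF bz] cblinfun_apply_sum cblinfun_apply_scaleC scaleC_complex_def)
  finally have *: "complex_of_real (\<Sum>i<Suc n. cmod (cblinfun_apply \<phi> (atom i))) =
      cblinfun_apply \<phi> (mult_op (\<lambda>i. if i < Suc n then z i else 0) 0)" .
  have "(\<Sum>i<Suc n. cmod (cblinfun_apply \<phi> (atom i))) \<le>
      cmod (complex_of_real (\<Sum>i<Suc n. cmod (cblinfun_apply \<phi> (atom i))))"
    unfolding norm_of_real by (rule abs_ge_self)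
  also have "\<dots> \<le> norm \<phi> * norm (mult_op (\<lambda>i. if i < Suc n then z i else 0) 0)"
    unfolding * by (rule norm_cblinfun)
  also have "\<dots> \<le> norm \<phi> * 1"
    by (intro mult_left_mono norm_mult_op) (use z1 in auto)
  finally show "(\<Sum>i\<le>n. cmod (cblinfun_apply \<phi> (atom i))) \<le> norm \<phi>"
    by (simp only: lessThan_Suc_atMost mult_1_right)
qed simp

lemma functional_mult_op_sums:
  fixes \<phi> :: "ell2 op_dual"
  assumes f: "f \<longlonglongrightarrow> 0"
  shows "(\<lambda>i. f i * cblinfun_apply \<phi> (atom i)) sums cblinfun_apply \<phi> (mult_op f 0)"
proof -
  have bf: "Bseq f" using f by (auto intro: convergent_imp_Bseq convergentI)
  have "(\<lambda>n. mult_op (\<lambda>i. if i < n then f i else 0) 0) \<longlonglongrightarrow> mult_op f 0"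
  proof (rule tendstoI)
    fix e :: real assume e: "e > 0"
    then have "\<forall>\<^sub>F i in sequentially. cmod (f i) < e / 2"
      using tendstoD[OF f, of "e / 2"] by simp
    then obtain N where N: "\<And>i. i \<ge> N \<Longrightarrow> cmod (f i) < e / 2"
      by (auto simp: eventually_sequentially)
    have "dist (mult_op (\<lambda>i. if i < n then f i else 0) 0) (mult_op f 0) < e" if "n \<ge> N" for n
    proof -
      have "(\<lambda>i. (if i < n then f i else 0) + (if i \<ge> n then f i else 0)) = f" by auto
      then have "mult_op f 0 = mult_op (\<lambda>i. if i < n then f i else 0) 0 + mult_op (\<lambda>i. if i \<ge> n then f i else 0) 0"
        by (simp add: mult_op_add Bseq_if bf)
      moreover have "norm (mult_op (\<lambda>i. if i \<ge> n then f i else 0) 0) \<le> e / 2"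
        by (rule norm_mult_op) (use N that e in \<open>auto intro: less_imp_le\<close>)
      ultimately show ?thesis using e by (simp add: dist_norm norm_minus_commute)
    qed
    then show "\<forall>\<^sub>F n in sequentially. dist (mult_op (\<lambda>i. if i < n then f i else 0) 0) (mult_op f 0) < e"
      by (auto simp: eventually_sequentially)
  qed
  from tendsto_cblinfun_apply[OF this, of \<phi>] show ?thesis
    by (simp only: sums_def mult_op_finite[OF bf] cblinfun_apply_sum cblinfun_apply_scaleC scaleC_complex_def)
qed

text \<open>Subtract the unit \<open>mult_op (\<lambda>_. 1) 1\<close>: the differences \<open>f n - 1\<close> are null sequences, so the
  functional evaluates them through its summable sequence on the atoms, and there pointwise convergence
  with a uniform bound suffices (Tannery).  The limit does not depend on \<open>f\<close>, which is why powers of a peak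
  function and tail indicators define the same element of the bidual.\<close>

lemma functional_mult_op_limit:
  fixes \<phi> :: "ell2 op_dual"
  assumes at_inf: "\<And>n. f n \<longlonglongrightarrow> 1"
    and pointwise: "\<And>i. (\<lambda>n. f n i) \<longlonglongrightarrow> 0"
    and bound: "\<And>n i. cmod (f n i) \<le> 1"
  shows "(\<lambda>n. cblinfun_apply \<phi> (mult_op (f n) 1)) \<longlonglongrightarrow>
    cblinfun_apply \<phi> (mult_op (\<lambda>_. 1) 1) - (\<Sum>i. cblinfun_apply \<phi> (atom i))"
proof -
  define \<psi> where "\<psi> i = cblinfun_apply \<phi> (atom i)" for i
  have s: "summable (\<lambda>i. cmod (\<psi> i))"
    unfolding \<psi>_def by (rule summable_functional_atoms)
  have *: "cblinfun_apply \<phi> (mult_op (f n) 1)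
      = cblinfun_apply \<phi> (mult_op (\<lambda>_. 1) 1) + (\<Sum>i. (f n i - 1) * \<psi> i)" for n
  proof -
    have l: "(\<lambda>i. f n i - 1) \<longlonglongrightarrow> 0"
      using tendsto_diff[OF at_inf tendsto_const[of 1]] by simp
    then have "Bseq (\<lambda>i. f n i - 1)" by (auto intro: convergent_imp_Bseq convergentI)
    then have "mult_op (f n) 1 = mult_op (\<lambda>_. 1) 1 + mult_op (\<lambda>i. f n i - 1) 0"
      by (simp add: mult_op_add)
    then show ?thesis
      using functional_mult_op_sums[OF l, of \<phi>] by (simp add: cblinfun_apply_add sums_iff \<psi>_def)
  qed
  have "(\<lambda>n. \<Sum>i. (f n i - 1) * \<psi> i) \<longlonglongrightarrow> (\<Sum>i. (0 - 1) * \<psi> i)"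
  proof (rule tannerys_theorem[THEN conjunct2, THEN conjunct2])
    show "(\<lambda>n. (f n i - 1) * \<psi> i) \<longlonglongrightarrow> (0 - 1) * \<psi> i" for i
      by (intro tendsto_intros pointwise)
    show "summable (\<lambda>i. 2 * cmod (\<psi> i))" by (intro summable_mult s)
    have "cmod ((f n i - 1) * \<psi> i) \<le> 2 * cmod (\<psi> i)" for n i
      using norm_triangle_ineq4[of "f n i" 1] bound[of n i]
      by (auto simp: norm_mult intro: mult_right_mono)
    then show "\<forall>\<^sub>F (i, n) in sequentially \<times>\<^sub>F sequentially. cmod ((f n i - 1) * \<psi> i) \<le> 2 * cmod (\<psi> i)"
      by (intro always_eventually) auto
  qed simp
  then have "(\<lambda>n. cblinfun_apply \<phi> (mult_op (\<lambda>_. 1) 1) + (\<Sum>i. (f n i - 1) * \<psi> i)) \<longlonglongrightarrow>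
      cblinfun_apply \<phi> (mult_op (\<lambda>_. 1) 1) + (\<Sum>i. (0 - 1) * \<psi> i)"
    by (intro tendsto_add tendsto_const)
  moreover have "(\<Sum>i. (0 - 1) * \<psi> i) = - (\<Sum>i. \<psi> i)"
    using summable_norm_cancel[OF s] by (simp add: suminf_minus)
  ultimately show ?thesis
    by (simp add: * \<psi>_def)
qed

section \<open>The peak projection\<close>

definition cutoff :: "nat \<Rightarrow> (ell2 \<Rightarrow>\<^sub>C\<^sub>L ell2)"
  where "cutoff N = mult_op (\<lambda>i. if i < N then 0 else 1) 1"

text \<open>Tail indicators are self-adjoint idempotents with \<open>cutoff N o\<^sub>C cutoff M = cutoff (max N M)\<close>.  The
  peak projection is therefore defined as their weak* limit, and its algebraic properties and its
  products with elements of the algebra are computed along this sequence.\<close>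

definition limit_projection :: "ell2 op_bidual"
  where "limit_projection = CBlinfun (\<lambda>\<phi>. lim (\<lambda>N. cblinfun_apply \<phi> (cutoff N)))"

lemma norm_cutoff: "norm (cutoff N) \<le> 1"
  unfolding cutoff_def by (rule norm_mult_op) auto

lemma tail_indicator_limits:
  "(\<lambda>i. if i < N then 0 else 1) \<longlonglongrightarrow> (1::complex)"
  "(\<lambda>N. if i < N then 0 else 1) \<longlonglongrightarrow> (0::complex)"
  by (rule tendsto_eventually, rule eventually_sequentiallyI[of N], simp)
    (rule tendsto_eventually, rule eventually_sequentiallyI[of "Suc i"], simp)

lemma functional_cutoff_limit:
  fixes \<phi> :: "ell2 op_dual"
  shows
  "(\<lambda>N. cblinfun_apply \<phi> (cutoff N)) \<longlonglongrightarrow>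
    cblinfun_apply \<phi> (mult_op (\<lambda>_. 1) 1) - (\<Sum>i. cblinfun_apply \<phi> (atom i))"
  unfolding cutoff_def 
  by (rule functional_mult_op_limit[where f="\<lambda>N i. if i < N then 0 else 1"])
    (auto intro: tail_indicator_limits)

lemma limit_projection_apply:
  "cblinfun_apply limit_projection \<phi> =
    cblinfun_apply \<phi> (mult_op (\<lambda>_. 1) 1) - (\<Sum>i. cblinfun_apply \<phi> (atom i))"
proof -
  have "bounded_clinear (\<lambda>\<phi> :: ell2 op_dual. lim (\<lambda>N. cblinfun_apply \<phi> (cutoff N)))"
  proof (rule bounded_clinearI[where K=1])
    fix \<phi> \<psi> :: "ell2 op_dual" and c :: complex
    note L = convergentI[OF functional_cutoff_limit, THEN convergent_LIMSEQ_iff[THEN iffD1]]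
    show "lim (\<lambda>N. cblinfun_apply (\<phi> + \<psi>) (cutoff N)) =
        lim (\<lambda>N. cblinfun_apply \<phi> (cutoff N)) + lim (\<lambda>N. cblinfun_apply \<psi> (cutoff N))"
      unfolding plus_cblinfun.rep_eq by (intro limI tendsto_add L)
    show "lim (\<lambda>N. cblinfun_apply (c *\<^sub>C \<phi>) (cutoff N)) = c *\<^sub>C lim (\<lambda>N. cblinfun_apply \<phi> (cutoff N))"
      unfolding scaleC_cblinfun.rep_eq scaleC_complex_def by (intro limI tendsto_mult tendsto_const L)
    show "norm (lim (\<lambda>N. cblinfun_apply \<phi> (cutoff N))) \<le> 1 * norm \<phi>"
    proof (rule LIMSEQ_le_const2[OF tendsto_norm[OF L]], intro exI allI impI)
      show "norm (cblinfun_apply \<phi> (cutoff N)) \<le> 1 * norm \<phi>" for N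
        using order_trans[OF norm_cblinfun mult_left_mono[OF norm_cutoff norm_ge_zero], of \<phi>] by simp
    qed
  qed
  then show ?thesis
    unfolding limit_projection_def
    by (simp add: cblinfun_apply_CBlinfun limI[OF functional_cutoff_limit])
qed

lemma limit_projection_tendsto:
  "(\<lambda>N. cblinfun_apply \<phi> (cutoff N)) \<longlonglongrightarrow> cblinfun_apply limit_projection \<phi>"
  unfolding limit_projection_apply by (rule functional_cutoff_limit)

lemma arens_limit_projection:
  "(\<lambda>N. cblinfun_apply \<phi> (T o\<^sub>C cutoff N)) \<longlonglongrightarrow>
    cblinfun_apply (bidual_embed T \<star> limit_projection) \<phi>"
  using limit_projection_tendsto[of "dual_right_act \<phi> T"]
  by (simp add: arens_prod_apply bidual_embed_apply bidual_act_apply dual_right_act_apply)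

lemma cblinfun_adj_eqI:
  "(\<And>x y. cinner (cblinfun_apply T x) y = cinner x (cblinfun_apply S y)) \<Longrightarrow> cblinfun_adj T = S"
  by (rule cblinfun_eqI, rule cinner_diff_zero_imp_eq) (simp flip: cinner_adj)

lemma mult_op_adj:
  assumes "Bseq f" "\<And>i. cnj (f i) = f i" "cnj p = p"
  shows "cblinfun_adj (mult_op f p) = mult_op f p"
proof (rule cblinfun_adj_eqI)
  fix x y
  have "ell2_apply (cblinfun_apply (mult_op f p) x) n * cnj (ell2_apply y n) =
      ell2_apply x n * cnj (ell2_apply (cblinfun_apply (mult_op f p) y) n)" for n
    by (rule mod4_cases[of _ n]) (simp_all only: tri_op_coords[OF assms(1) Bfun_const], simp_all add: assms)
  then show "cinner (cblinfun_apply (mult_op f p) x) y = cinner x (cblinfun_apply (mult_op f p) y)"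
    by (simp add: cinner_ell2.rep_eq)
qed

text \<open>The lower diagonal entry \<open>0 ^ n\<close> is \<open>1\<close> for \<open>n = 0\<close>, since the zeroth power is the identity of
  the whole Hilbert space and not the unit of the image of \<open>mult_op\<close>.\<close>

lemma mult_op_power:
  assumes "Bseq g"
  shows "cblinfun_power (mult_op g 1) n = tri_op (\<lambda>i. g i ^ n) 1 (\<lambda>_. 0) 0 (0 ^ n) \<and> Bseq (\<lambda>i. g i ^ n)"
proof (induction n)
  case 0
  then show ?case by (simp add: id_eq_tri_op)
next
  case (Suc n)
  then have "Bseq (\<lambda>i. g i ^ n)" by blast
  then show ?case
    using Suc assms by (simp add: tri_op_compose Bseq_mult_pointwise)
qed

lemma cutoff_compose: "cutoff N o\<^sub>C cutoff M = cutoff (max N M)"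
proof -
  have "Bseq (\<lambda>i. if i < n then 0 else (1::complex))" for n
    by (rule BseqI'[of _ 1]) simp
  then show ?thesis
    unfolding cutoff_def
    by (simp add: tri_op_compose) (rule arg_cong[where f="\<lambda>f. mult_op f 1"], auto simp: fun_eq_iff)
qed

lemma bidual_projection_limit_projection: "bidual_projection limit_projection"
  unfolding bidual_projection_def
proof
  show "limit_projection \<star> limit_projection = limit_projection"
  proof (rule cblinfun_eqI)
    fix \<phi> :: "ell2 op_dual"
    \<comment> \<open>The inner limit of \<open>\<phi> (cutoff N o\<^sub>C cutoff M)\<close> in \<open>M\<close> does not see \<open>N\<close>, so the outer limit is
      that of a constant sequence.\<close>
    have "cblinfun_apply limit_projection (dual_right_act \<phi> (cutoff N)) = cblinfun_apply limit_projection \<phi>" for N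
    proof (rule LIMSEQ_unique[OF limit_projection_tendsto])
      have "\<forall>\<^sub>F M in sequentially. cblinfun_apply \<phi> (cutoff M) = cblinfun_apply (dual_right_act \<phi> (cutoff N)) (cutoff M)"
        by (rule eventually_sequentiallyI[of N]) (simp add: dual_right_act_apply cutoff_compose max_absorb2)
      then show "(\<lambda>M. cblinfun_apply (dual_right_act \<phi> (cutoff N)) (cutoff M)) \<longlonglongrightarrow> cblinfun_apply limit_projection \<phi>"
        by (rule Lim_transform_eventually[OF limit_projection_tendsto])
    qed
    then have "(\<lambda>N. cblinfun_apply limit_projection \<phi>) \<longlonglongrightarrow> cblinfun_apply (limit_projection \<star> limit_projection) \<phi>"
      using limit_projection_tendsto[of "bidual_act limit_projection \<phi>"]
      by (simp add: arens_prod_apply bidual_act_apply)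
    then show "cblinfun_apply (limit_projection \<star> limit_projection) \<phi> = cblinfun_apply limit_projection \<phi>"
      by (simp add: LIMSEQ_const_iff)
  qed
  show "bidual_star limit_projection = limit_projection"
  proof (rule cblinfun_eqI)
    fix \<phi> :: "ell2 op_dual"
    have "cblinfun_adj (cutoff N) = cutoff N" for N
      unfolding cutoff_def by (rule mult_op_adj) (auto intro: BseqI'[of _ 1])
    then have "(\<lambda>N. cblinfun_apply \<phi> (cutoff N)) \<longlonglongrightarrow> cblinfun_apply (bidual_star limit_projection) \<phi>"
      using tendsto_cnj[OF limit_projection_tendsto[of "dual_star \<phi>"]]
      by (simp add: bidual_star_apply dual_star_apply)
    then show "cblinfun_apply (bidual_star limit_projection) \<phi> = cblinfun_apply limit_projection \<phi>"
      using LIMSEQ_unique limit_projection_tendsto by blast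
  qed
qed

definition peaking :: "nat \<Rightarrow> real"
  where "peaking i = 1 - weight (Suc i)"

lemma peaking_bounds: "0 \<le> peaking i" "peaking i < 1"
  by (simp_all add: peaking_def weight_pos weight_le_1)

lemma peaking_tendsto: "peaking \<longlonglongrightarrow> 1"
  using tendsto_diff[OF tendsto_const LIMSEQ_Suc[OF weight_tendsto_0], of 1]
  by (simp add: peaking_def[abs_def])

lemma peak_projection_limit_projection: "peak_projection witness_algebra limit_projection"
  unfolding peak_projection_def
proof (intro bexI conjI)
  let ?h = "\<lambda>i. complex_of_real (peaking i)"
  let ?a = "mult_op ?h 1"
  have h1: "cmod (?h i) \<le> 1" for i using peaking_bounds[of i] by simp
  have lim: "?h \<longlonglongrightarrow> 1" using tendsto_of_real[OF peaking_tendsto] by simp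
  have bh: "Bseq ?h" using h1 by (rule BseqI')
  show "?a \<in> witness_algebra" by (rule witness_algebraI[OF lim tendsto_const])
  show "norm ?a \<le> 1" by (rule norm_mult_op) (use h1 in auto)
  show "bidual_projection limit_projection" by (rule bidual_projection_limit_projection)
  have odd: "?a o\<^sub>C cblinfun_power (cblinfun_adj ?a o\<^sub>C ?a) n = mult_op (\<lambda>i. ?h i * (?h i * ?h i) ^ n) 1" for n
  proof -
    have "Bseq (\<lambda>i. ?h i * ?h i)" by (rule Bseq_mult_pointwise[OF bh bh])
    note p = mult_op_power[OF this, of n]
    have "cblinfun_adj ?a o\<^sub>C ?a = mult_op (\<lambda>i. ?h i * ?h i) 1"
      by (simp add: mult_op_adj[OF bh] tri_op_compose bh)
    then show ?thesis using p by (simp add: tri_op_compose bh)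
  qed
  show "weak_star_limit (\<lambda>n. bidual_embed (?a o\<^sub>C cblinfun_power (cblinfun_adj ?a o\<^sub>C ?a) n)) limit_projection"
    unfolding weak_star_limit_def odd bidual_embed_apply limit_projection_apply
  proof (rule allI, rule functional_mult_op_limit)
    show "(\<lambda>i. ?h i * (?h i * ?h i) ^ n) \<longlonglongrightarrow> 1" for n
      using tendsto_mult[OF lim tendsto_power[OF tendsto_mult[OF lim lim]]] by simp
    show "(\<lambda>n. ?h i * (?h i * ?h i) ^ n) \<longlonglongrightarrow> 0" for i
    proof (rule tendsto_mult_right_zero, rule LIMSEQ_power_zero)
      show "norm (?h i * ?h i) < 1"
        using peaking_bounds[of i] mult_strict_mono[of "peaking i" 1 "peaking i" 1]
        by (simp add: norm_mult del: of_real_mult)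
    qed
    show "cmod (?h i * (?h i * ?h i) ^ n) \<le> 1" for n i
      using h1[of i] by (simp add: norm_mult norm_power mult_le_one power_le_one del: norm_of_real)
  qed
qed

section \<open>The element whose restriction has no contractive lift\<close>

lemma cutoff_right_mult:
  assumes "Bseq f" "Bseq k"
  shows "tri_op f p k r c o\<^sub>C cutoff N =
    tri_op (\<lambda>i. if i < N then 0 else f i) p (\<lambda>i. if i < N then 0 else k i) r 0"
proof -
  have b: "Bseq (\<lambda>i. if i < n then 0 else (1::complex))" for n
    by (rule BseqI'[of _ 1]) simp
  show ?thesis
    unfolding cutoff_def
    by (simp add: tri_op_compose[OF assms b Bfun_const] if_distrib[of "(*) _"] cong: if_cong)
qed

text \<open>The product is a weak* limit of operators of norm at most \<open>1 + weight N\<close>: after multiplication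
  by \<open>cutoff N\<close> on the right, the entries from \<open>u'\<close> to \<open>w\<close> are \<open>weight i \<le> weight N\<close> for \<open>i \<ge> N\<close> and \<open>0\<close> before, and all other
  nonzero entries form a partial isometry.\<close>

lemma norm_arens_limit_projection_le:
  "norm (bidual_embed (tri_op (\<lambda>_. 0) 0 (\<lambda>_. 1) 1 0) \<star> limit_projection) \<le> 1"
proof (rule norm_cblinfun_bound)
  fix \<phi> :: "ell2 op_dual"
  let ?b = "tri_op (\<lambda>_. 0) 0 (\<lambda>_. 1) 1 0"
  show "norm (cblinfun_apply (bidual_embed ?b \<star> limit_projection) \<phi>) \<le> 1 * norm \<phi>"
  proof (rule LIMSEQ_le[OF tendsto_norm[OF arens_limit_projection]])
    have "(\<lambda>N. (1 + weight N) * norm \<phi>) \<longlonglongrightarrow> (1 + 0) * norm \<phi>"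
      by (intro tendsto_intros weight_tendsto_0)
    then show "(\<lambda>N. (1 + weight N) * norm \<phi>) \<longlonglongrightarrow> 1 * norm \<phi>" by simp
    have "norm (cblinfun_apply \<phi> (?b o\<^sub>C cutoff N)) \<le> (1 + weight N) * norm \<phi>" for N
    proof -
      have "norm (?b o\<^sub>C cutoff N) \<le> 0 + 1 + weight N"
        unfolding cutoff_right_mult[OF Bfun_const Bfun_const]
        by (rule norm_tri_op) (auto simp: weight_def frac_le)
      then have "norm \<phi> * norm (?b o\<^sub>C cutoff N) \<le> norm \<phi> * (0 + 1 + weight N)"
        by (intro mult_left_mono norm_ge_zero)
      with norm_cblinfun[of \<phi> "?b o\<^sub>C cutoff N"] show ?thesis
        by (simp add: mult.commute)
    qed
    then show "\<exists>M. \<forall>N\<ge>M. norm (cblinfun_apply \<phi> (?b o\<^sub>C cutoff N)) \<le> (1 + weight N) * norm \<phi>"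
      by blast
  qed
qed simp

text \<open>The entry from \<open>u\<close> to \<open>w\<close> in the first block is a bounded functional, and multiplication by
  \<open>cutoff N\<close> on the right does not change it.  This is the reason for a copy of the point at infinity
  in the Hilbert space: the product with the limit projection determines \<open>r\<close> by a vector functional.\<close>

lemma limit_entry_determined:
  assumes "Bseq f" "Bseq k" "Bseq f'" "Bseq k'"
    and eq: "bidual_embed (tri_op f p k r c) \<star> limit_projection =
      bidual_embed (tri_op f' p' k' r' c') \<star> limit_projection"
  shows "r = r'"
proof -
  define \<phi> :: "ell2 op_dual" where "\<phi> = CBlinfun (\<lambda>T. entry T 2 0)"
  have "bounded_clinear (\<lambda>T. entry T 2 0)"
    by (rule bounded_clinearI[where K=1])
      (simp_all add: plus_cblinfun.rep_eq plus_ell2.rep_eq scaleC_cblinfun.rep_eq scaleC_ell2.rep_eq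
        scaleC_complex_def cmod_entry_le)
  then have \<phi>: "cblinfun_apply \<phi> T = entry T 2 0" for T
    by (simp add: \<phi>_def cblinfun_apply_CBlinfun)
  have val: "cblinfun_apply (bidual_embed (tri_op f p k r c) \<star> limit_projection) \<phi> = r"
    if "Bseq f" "Bseq k" for f p k r c
  proof (rule LIMSEQ_unique[OF arens_limit_projection])
    have "entry (tri_op f p k r c o\<^sub>C cutoff N) 2 0 = r" for N
      using that by (simp add: cutoff_right_mult tri_op_entries Bseq_if_not)
    then show "(\<lambda>N. cblinfun_apply \<phi> (tri_op f p k r c o\<^sub>C cutoff N)) \<longlonglongrightarrow> r"
      by (simp add: \<phi>)
  qed
  show ?thesis using val[OF assms(1,2), of p r c] val[OF assms(3,4), of p' r' c'] eq by simp
qed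

text \<open>The row \<open>(1, weight i * k i)\<close> of a contraction has Euclidean norm at most \<open>1\<close>.  The vector \<open>x\<close> is
  the conjugate of this row, where the estimate for the row is sharp.\<close>

lemma row_forces_zero:
  assumes "Bseq f" "Bseq k" and contr: "norm (tri_op f p k 1 c) \<le> 1"
  shows "k i = 0"
proof -
  define t where "t = complex_of_real (weight i) * k i"
  define x where "x = ket (4 * i) + cnj t *\<^sub>C ket (4 * i + 1)"
  have nx: "(norm x)\<^sup>2 = 1 + (cmod t)\<^sup>2"
    unfolding x_def by (simp add: norm_add_sq norm_ket norm_scaleC cinner_scaleC_right cinner_ket_right ket_apply)
  have "ell2_apply (cblinfun_apply (tri_op f p k 1 c) x) (4 * i + 2) = 1 + t * cnj t"
    unfolding tri_op_coords[OF assms(1,2)] t_def x_def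
    by (simp add: plus_ell2.rep_eq scaleC_ell2.rep_eq ket_apply)
  also have "\<dots> = complex_of_real ((norm x)\<^sup>2)"
    unfolding nx by (simp add: complex_norm_square del: of_real_power)
  finally have "(norm x)\<^sup>2 \<le> norm (cblinfun_apply (tri_op f p k 1 c) x)"
    using cmod_ell2_apply_le[of "cblinfun_apply (tri_op f p k 1 c) x" "4 * i + 2"] by (simp del: of_real_power)
  also have "\<dots> \<le> 1 * norm x"
    using norm_cblinfun mult_right_mono[OF contr norm_ge_zero] by (rule order_trans)
  finally have "norm x \<le> 1"
    by (cases "norm x = 0") (auto simp: power2_eq_square)
  then have "(norm x)\<^sup>2 \<le> 1" by (simp add: power_le_one)
  then have "t = 0" unfolding nx by simp
  then show ?thesis using weight_pos[of i] by (simp add: t_def)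
qed

theorem corollary2p4:
  shows "\<exists>(A :: (ell2 \<Rightarrow>\<^sub>C\<^sub>L ell2) set) q b.
    unital_operator_algebra A \<and> peak_projection A q \<and> b \<in> A \<and>
    norm (bidual_embed b \<star> q) \<le> 1 \<and>
    \<not> (\<exists>g\<in>A. norm g \<le> 1 \<and> bidual_embed g \<star> q = bidual_embed b \<star> q)"
proof (intro exI conjI)
  let ?b = "tri_op (\<lambda>_. 0) 0 (\<lambda>_. 1) 1 0"
  show "unital_operator_algebra witness_algebra" by (rule unital_operator_algebra_witness)
  show "peak_projection witness_algebra limit_projection" by (rule peak_projection_limit_projection)
  show "?b \<in> witness_algebra" by (intro witness_algebraI tendsto_const)
  show "norm (bidual_embed ?b \<star> limit_projection) \<le> 1" by (rule norm_arens_limit_projection_le)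
  show "\<not> (\<exists>g\<in>witness_algebra. norm g \<le> 1 \<and>
      bidual_embed g \<star> limit_projection = bidual_embed ?b \<star> limit_projection)"
  proof (rule notI, elim bexE conjE)
    fix g
    assume "g \<in> witness_algebra" and contr: "norm g \<le> 1"
      and eq: "bidual_embed g \<star> limit_projection = bidual_embed ?b \<star> limit_projection"
    then obtain f p k r c where g: "g = tri_op f p k r c" and k: "k \<longlonglongrightarrow> r" and bs: "Bseq f" "Bseq k"
      by (meson witness_algebraE)
    have "r = 1"
      using limit_entry_determined[OF bs Bfun_const Bfun_const eq[unfolded g]] .
    then have "k i = 0" for i
      using row_forces_zero[OF bs contr[unfolded g \<open>r = 1\<close>]] by simp
    then have "k = (\<lambda>_. 0)" by (rule ext)
    then have "k \<longlonglongrightarrow> 0" by simp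
    with k \<open>r = 1\<close> show False using LIMSEQ_unique by fastforce
  qed
qed

end
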